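(* Let $(\varphi_{s,t})$ be an evolution family of order $d\in[1,+\infty]$ and let $\beta:=\lim_{t\to+\infty}\frac{|\varphi_{0,t}'(0)|}{1-|\varphi_{0,t}(0)|^2}$. Then there exists a normalized Loewner chain $(f_t)$ of order $d$ associated with $(\varphi_{s,t})$ such that $\Omega:=\bigcup_{t\ge0}f_t(\mathbb D)$ coincides with the disk $\{z:|z|<1/\beta\}$ if $\beta>0$ and with $\mathbb C$ if $\beta=0$.
   Context: $\mathbb D$ is the open unit disk. For $d\in[1,+\infty]$, an evolution family of order $d$ is a family $(\varphi_{s,t})_{0\le s\le t<+\infty}$ of holomorphic self-maps of $\mathbb D$ with $\varphi_{s,s}=\mathrm{id}_{\mathbb D}$, $\varphi_{s,t}=\varphi_{u,t}\circ\varphi_{s,u}$ for $0\le s\le u\le t$, and such that for every $z\in\mathbb D$, $T>0$ there is a non-negative $k_{z,T}\in L^d([0,T])$ with $|\varphi_{s,u}(z)-\varphi_{s,t}(z)|\le\int_u^tk_{z,T}$ for all $0\le s\le u\le t\le T$. A Loewner chain of order $d$ is a family $(f_t)_{t\ge0}$ of univalent holomorphic maps $f_t:\mathbb D\to\mathbb C$ with $f_s(\mathbb D)\subset f_t(\mathbb D)$ for $s<t$ and such that for every compact $K\subset\mathbb D$ and $T>0$ there is a non-negative $k_{K,T}\in L^d([0,T])$ with $|f_s(z)-f_t(z)|\le\int_s^tk_{K,T}$ for $z\in K$, $0\le s\le t\le T$. It is normalized if $f_0(0)=0$, $f_0'(0)=1$, and associated with $(\varphi_{s,t})$ if $f_t\circ\varphi_{s,t}=f_s$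 for all $0\le s\le t$. *)

theory Defs
  imports "HOL-Complex_Analysis.Complex_Analysis"
begin

definition Ld_nonneg :: "ereal \<Rightarrow> real \<Rightarrow> (real \<Rightarrow> real) \<Rightarrow> bool" where
  "Ld_nonneg d T k \<longleftrightarrow>
     (\<forall>x. 0 \<le> k x) \<and> set_borel_measurable lebesgue {0..T} k \<and>
     (if d = \<infinity> then (\<exists>C. AE x in lebesgue. x \<in> {0..T} \<longrightarrow> k x \<le> C)
      else set_integrable lebesgue {0..T} (\<lambda>x. k x powr real_of_ereal d))"

abbreviation unit_disk :: "complex set" where "unit_disk \<equiv> ball 0 1"

definition evolution_family :: "ereal \<Rightarrow> (real \<Rightarrow> real \<Rightarrow> complex \<Rightarrow> complex) \<Rightarrow> bool" where
  "evolution_family d \<phi> \<longleftrightarrow>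
     (\<forall>s t. 0 \<le> s \<and> s \<le> t \<longrightarrow> \<phi> s t holomorphic_on unit_disk \<and> \<phi> s t ` unit_disk \<subseteq> unit_disk) \<and>
     (\<forall>s z. 0 \<le> s \<and> z \<in> unit_disk \<longrightarrow> \<phi> s s z = z) \<and>
     (\<forall>s u t z. 0 \<le> s \<and> s \<le> u \<and> u \<le> t \<and> z \<in> unit_disk \<longrightarrow> \<phi> s t z = \<phi> u t (\<phi> s u z)) \<and>
     (\<forall>z \<in> unit_disk. \<forall>T > 0. \<exists>k. Ld_nonneg d T k \<and>
        (\<forall>s u t. 0 \<le> s \<and> s \<le> u \<and> u \<le> t \<and> t \<le> T \<longrightarrow>
           cmod (\<phi> s u z - \<phi> s t z) \<le> set_lebesgue_integral lebesgue {u..t} k))"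

definition loewner_chain :: "ereal \<Rightarrow> (real \<Rightarrow> complex \<Rightarrow> complex) \<Rightarrow> bool" where
  "loewner_chain d f \<longleftrightarrow>
     (\<forall>t \<ge> 0. f t holomorphic_on unit_disk \<and> inj_on (f t) unit_disk) \<and>
     (\<forall>s t. 0 \<le> s \<and> s < t \<longrightarrow> f s ` unit_disk \<subseteq> f t ` unit_disk) \<and>
     (\<forall>K T. compact K \<and> K \<subseteq> unit_disk \<and> T > 0 \<longrightarrow> (\<exists>k. Ld_nonneg d T k \<and>
        (\<forall>z \<in> K. \<forall>s t. 0 \<le> s \<and> s \<le> t \<and> t \<le> T \<longrightarrow>
           cmod (f s z - f t z) \<le> set_lebesgue_integral lebesgue {s..t} k)))"

definition normalized_chain :: "(real \<Rightarrow> complex \<Rightarrow> complex) \<Rightarrow> bool" where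
  "normalized_chain f \<longleftrightarrow> f 0 0 = 0 \<and> deriv (f 0) 0 = 1"

definition associated_with ::
  "(real \<Rightarrow> complex \<Rightarrow> complex) \<Rightarrow> (real \<Rightarrow> real \<Rightarrow> complex \<Rightarrow> complex) \<Rightarrow> bool" where
  "associated_with f \<phi> \<longleftrightarrow>
     (\<forall>s t z. 0 \<le> s \<and> s \<le> t \<and> z \<in> unit_disk \<longrightarrow> f t (\<phi> s t z) = f s z)"

end

(* Conjugating by disk automorphisms that send phi_{0,t}(0) to 0 turns the evolution family into
   self-maps psi_{s,t} fixing 0, and beta becomes the limit of |psi_{0,t}'(0)|.  Put
   F_t = psi_{s,t} / psi_{s,t}'(0).  Schwarz-Pick applied to psi_{t,u}(z)/z bounds |F_u/F_t - 1|,
   for nearby t < u, by a multiple of |psi_{s,t}(z)| - |psi_{s,u}(z)|.  These increments telescope,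
   so F_t is locally bounded and Cauchy as t tends to infinity, with no appeal to the Koebe
   distortion theorem.  The limits g_s of psi_{s,t} / psi_{0,t}'(0) are univalent by Hurwitz, and
   undoing the conjugation gives the chain.  The range follows from a covering estimate for
   self-maps of the disk with given derivative at 0.

   Univalence of phi holds because phi_{s,t} is uniformly close to the identity for small t - s.
   The same estimate, linear in |phi_{s,t}(0)| + |phi_{s,t}(1/2) - 1/2|, yields a single kernel on
   each compact set. *)
theory Submission
  imports Defs
begin

subsection \<open>Schwarz--Pick estimates\<close>

text \<open>The bound on the relative change of F holds only while the derivative of
  \<open>\<psi> t u\<close> at 0 stays away from 0, so a long time interval has to be cut into
  pieces whose number is not controlled. This is harmless because each step is measured by the drop
  of \<open>cmod (\<psi> s t z)\<close>: the drops add up to at most 1 however many pieces there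
  are, and 1 + x <= exp x turns the product of the step factors into a single exponential.
  Univalence is not part of the definition of an evolution family, yet it is what makes the
  derivatives at 0 nonzero, so it must precede every normalization; it is proved by following two
  orbits through short time steps. The kernels in the definition belong to single points. The points
  0 and 1/2 carry the information for a whole compact set because a holomorphic self-map of the disk
  fixing two points is the identity, and this rigidity has a quantitative form.\<close>

lemma cmod_one_minus_cnj_mult_sq:
  fixes a z :: complex
  shows "(cmod (1 - cnj a * z))\<^sup>2 - (cmod (z - a))\<^sup>2 = (1 - (cmod a)\<^sup>2) * (1 - (cmod z)\<^sup>2)"
  unfolding cmod_power2 by (simp add: algebra_simps power2_eq_square)

lemma one_minus_cnj_mult_nonzero:
  assumes "cmod a < 1" "cmod z \<le> 1"
  shows "1 - cnj a * z \<noteq> 0"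
proof
  assume "1 - cnj a * z = 0"
  then have "cmod (cnj a * z) = 1" by simp
  moreover have "cmod (cnj a * z) \<le> cmod a * 1"
    unfolding norm_mult using assms by (intro mult_mono) auto
  ultimately show False using assms by simp
qed

lemma cmod_one_minus_cnj_mult_le_2:
  assumes "cmod a \<le> 1" "cmod z \<le> 1"
  shows "cmod (1 - cnj a * z) \<le> 2"
proof -
  have "cmod (cnj a * z) \<le> 1 * 1"
    unfolding norm_mult using assms by (intro mult_mono) auto
  then show ?thesis using norm_triangle_ineq4[of 1 "cnj a * z"] by simp
qed

lemma Schwarz_Pick_ball:
  assumes holf: "f holomorphic_on ball 0 1" and fim: "f ` ball 0 1 \<subseteq> ball 0 1"
    and z: "cmod z < 1" and w: "cmod w < 1"
  shows "cmod (f z - f w) * cmod (1 - cnj w * z) \<le> cmod (z - w) * cmod (1 - cnj (f w) * f z)"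
proof -
  have f1: "cmod (f x) < 1" if "cmod x < 1" for x using fim that by force
  define g where "g = Moebius_function 0 (f w) \<circ> f \<circ> Moebius_function 0 (-w)"
  have Mim: "Moebius_function 0 a ` ball 0 1 \<subseteq> ball 0 1" if "cmod a < 1" for a
    using Moebius_function_norm_lt_1 that by auto
  have wm: "cmod (-w) < 1" using w by simp
  have holg: "g holomorphic_on ball 0 1" unfolding g_def
    by (intro holomorphic_on_compose_gen[of _ _ _ "ball 0 1"] Moebius_function_holomorphic holf fim Mim wm f1 w)
  have g0: "g 0 = 0" by (simp add: g_def Moebius_function_of_zero Moebius_function_eq_zero)
  have g1: "cmod (g x) < 1" if "cmod x < 1" for x
    unfolding g_def o_def by (intro Moebius_function_norm_lt_1 f1 w wm that)
  have mz: "cmod (Moebius_function 0 w z) < 1" using Moebius_function_norm_lt_1 w z by auto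
  have "cmod (g (Moebius_function 0 w z)) \<le> cmod (Moebius_function 0 w z)"
    by (rule Schwarz_Lemma(1)[OF holg g0 g1 mz])
  also have "g (Moebius_function 0 w z) = Moebius_function 0 (f w) (f z)"
    unfolding g_def using Moebius_function_compose[of "-w" w z] w z by simp
  finally have "cmod (Moebius_function 0 (f w) (f z)) \<le> cmod (Moebius_function 0 w z)" .
  then have "cmod (f z - f w) / cmod (1 - cnj (f w) * f z) \<le> cmod (z - w) / cmod (1 - cnj w * z)"
    by (simp add: Moebius_function_simple norm_divide)
  moreover have "1 - cnj (f w) * f z \<noteq> 0" "1 - cnj w * z \<noteq> 0"
    using one_minus_cnj_mult_nonzero f1 w z by (auto simp: less_imp_le)
  ultimately show ?thesis by (simp add: divide_simps mult.commute)
qed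

text \<open>The closed disk is allowed as target because f(z)/z, for a self-map f fixing 0, can be a
  unimodular constant. The cross-multiplied form stays meaningful there, where
  \<open>1 - cnj (f w) * f z\<close> vanishes. A nonconstant map has open image, hence lands in the
  open disk.\<close>

lemma Schwarz_Pick:
  assumes holf: "f holomorphic_on ball 0 1" and fim: "f ` ball 0 1 \<subseteq> cball 0 1"
    and z: "cmod z < 1" and w: "cmod w < 1"
  shows "cmod (f z - f w) * cmod (1 - cnj w * z) \<le> cmod (z - w) * cmod (1 - cnj (f w) * f z)"
proof (cases "f constant_on ball 0 1")
  case True
  then have "f z = f w" using z w unfolding constant_on_def by (metis mem_ball_0)
  then show ?thesis by simp
next
  case False
  have "open (f ` ball 0 1)"
    by (rule open_mapping_thm[OF holf _ _ _ order_refl False]) auto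
  then have "f ` ball 0 1 \<subseteq> interior (cball 0 1)"
    using fim by (intro interior_maximal)
  then show ?thesis using Schwarz_Pick_ball holf z w unfolding interior_cball by blast
qed

lemma Schwarz_quotient:
  assumes holf: "f holomorphic_on ball 0 1" and fim: "f ` ball 0 1 \<subseteq> ball 0 1" and f0: "f 0 = 0"
  obtains p where "p holomorphic_on ball 0 1" "p ` ball 0 1 \<subseteq> cball 0 1" "p 0 = deriv f 0"
    "\<And>z. cmod z < 1 \<Longrightarrow> f z = z * p z"
proof -
  obtain h where h: "h holomorphic_on ball 0 1" "\<And>z. norm z < 1 \<Longrightarrow> f z = z * h z" "deriv f 0 = h 0"
    using Schwarz3[OF holf f0] by auto
  have no: "\<And>z. norm z < 1 \<Longrightarrow> norm (f z) < 1" using fim by force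
  have "cmod (h z) \<le> 1" if "cmod z < 1" for z
  proof (cases "z = 0")
    case True
    then show ?thesis using Schwarz_Lemma(2)[OF holf f0 no, of 0] h by simp
  next
    case False
    have "cmod z * cmod (h z) \<le> cmod z" using Schwarz_Lemma(1)[OF holf f0 no that] h(2)[OF that] by (simp add: norm_mult)
    then show ?thesis using False by simp
  qed
  then show ?thesis using that h by force
qed

text \<open>Meant for f(z) = \<psi>(z)/z: there 1 - |f(0)| is the defect of the derivative of \<psi>
  at 0 and 1 - |f(z)| the relative loss of modulus at z. The first two estimates make these defects
  comparable, the third bounds the oscillation of f by the defect at 0.\<close>

lemma Schwarz_Pick_origin:
  assumes holf: "f holomorphic_on ball 0 1" and fim: "f ` ball 0 1 \<subseteq> cball 0 1" and z: "cmod z < 1"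
  shows "(1 - cmod (f 0)) * (1 - (cmod z)\<^sup>2) \<le> 4 * (1 - cmod (f z))"
    and "(1 - cmod (f z)) * (1 - (cmod z)\<^sup>2) \<le> 4 * (1 - cmod (f 0))"
    and "cmod (f z - f 0) * (1 - cmod z) \<le> 2 * cmod z * (1 - cmod (f 0))"
proof -
  define c p r where "c = f 0" and "p = f z" and "r = cmod z"
  have r: "0 \<le> r" "r < 1" and c1: "cmod c \<le> 1" and p1: "cmod p \<le> 1"
    using z fim by (auto simp: c_def p_def r_def image_subset_iff)
  have sp: "cmod (p - c) \<le> r * cmod (1 - cnj c * p)"
    using Schwarz_Pick[OF holf fim z, of 0] by (simp add: c_def p_def r_def)
  have "(cmod (p - c))\<^sup>2 \<le> r\<^sup>2 * (cmod (1 - cnj c * p))\<^sup>2"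
    using power_mono[OF sp, of 2] by (simp add: power_mult_distrib)
  then have A: "(1 - r\<^sup>2) * (cmod (1 - cnj c * p))\<^sup>2 \<le> (1 - (cmod c)\<^sup>2) * (1 - (cmod p)\<^sup>2)"
    using cmod_one_minus_cnj_mult_sq[of c p] by (simp add: algebra_simps)
  have cp: "cmod (cnj c * p) = cmod c * cmod p" by (simp add: norm_mult)
  have B: "1 - cmod c * cmod p \<le> cmod (1 - cnj c * p)"
    using norm_triangle_ineq2[of 1 "cnj c * p"] cp by simp
  have r2: "0 \<le> 1 - r\<^sup>2" using r by (simp add: power_le_one)
  \<comment> \<open>The premise is symmetric in x and y, so one computation yields both comparisons.
    A factor 1 - x is cancelled, and (1 + x)(1 + y) <= 4 gives the constant.\<close>
  have key: "(1 - x) * (1 - r\<^sup>2) \<le> 4 * (1 - y)"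
    if "(1 - r\<^sup>2) * (1 - x * y)\<^sup>2 \<le> (1 - x\<^sup>2) * (1 - y\<^sup>2)" "0 \<le> x" "x \<le> 1" "0 \<le> y" "y \<le> 1" for x y :: real
  proof (cases "x = 1")
    case False
    have "(1 - x)\<^sup>2 \<le> (1 - x * y)\<^sup>2" using that by (intro power_mono) (auto simp: mult_left_le)
    then have "(1 - r\<^sup>2) * (1 - x)\<^sup>2 \<le> (1 - x\<^sup>2) * (1 - y\<^sup>2)" using r2 that(1) mult_left_mono by (metis order_trans)
    then have "(1 - x) * ((1 - r\<^sup>2) * (1 - x)) \<le> (1 - x) * ((1 + x) * (1 + y) * (1 - y))"
      by (simp add: power2_eq_square algebra_simps)
    then have "(1 - r\<^sup>2) * (1 - x) \<le> (1 + x) * (1 + y) * (1 - y)"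
      using False that by (simp add: mult_le_cancel_left)
    also have "\<dots> \<le> (2 * 2) * (1 - y)" using that by (intro mult_right_mono mult_mono) auto
    finally show ?thesis by (simp add: mult.commute)
  qed (use that in auto)
  have "(1 - r\<^sup>2) * (1 - cmod c * cmod p)\<^sup>2 \<le> (1 - r\<^sup>2) * (cmod (1 - cnj c * p))\<^sup>2"
    using r2 B c1 p1 by (intro mult_left_mono power_mono) (auto simp: mult_le_one)
  then have D: "(1 - r\<^sup>2) * (1 - cmod c * cmod p)\<^sup>2 \<le> (1 - (cmod c)\<^sup>2) * (1 - (cmod p)\<^sup>2)" using A by simp
  show "(1 - cmod (f 0)) * (1 - (cmod z)\<^sup>2) \<le> 4 * (1 - cmod (f z))"
    using key[of "cmod c" "cmod p"] D c1 p1 by (simp add: c_def p_def r_def)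
  show "(1 - cmod (f z)) * (1 - (cmod z)\<^sup>2) \<le> 4 * (1 - cmod (f 0))"
    using key[of "cmod p" "cmod c"] D c1 p1 by (simp add: c_def p_def r_def mult.commute)
  \<comment> \<open>This puts |p - c| on both sides of Schwarz-Pick, the right-hand one with
    coefficient at most r; absorbing it produces the factor 1 - r.\<close>
  have eq: "1 - cnj c * p = (1 - complex_of_real ((cmod c)\<^sup>2)) - cnj c * (p - c)"
    using complex_norm_square[of c] by (simp add: algebra_simps)
  have "cmod (1 - cnj c * p) \<le> cmod (1 - complex_of_real ((cmod c)\<^sup>2)) + cmod c * cmod (p - c)"
    using norm_triangle_ineq4[of "1 - complex_of_real ((cmod c)\<^sup>2)" "cnj c * (p - c)"]
    unfolding eq norm_mult complex_mod_cnj .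
  moreover have "cmod (1 - complex_of_real ((cmod c)\<^sup>2)) = 1 - (cmod c)\<^sup>2"
    using c1 norm_of_real[of "1 - (cmod c)\<^sup>2", where 'a=complex] by (simp add: power_le_one)
  moreover have "cmod c * cmod (p - c) \<le> cmod (p - c)" using c1 by (simp add: mult_left_le_one_le)
  moreover have "1 - (cmod c)\<^sup>2 \<le> 2 * (1 - cmod c)"
    using c1 zero_le_power2[of "1 - cmod c"] by (simp add: power2_eq_square algebra_simps)
  ultimately have "cmod (1 - cnj c * p) \<le> 2 * (1 - cmod c) + cmod (p - c)" by linarith
  then have "cmod (p - c) \<le> r * (2 * (1 - cmod c) + cmod (p - c))"
    using sp r mult_left_mono by (metis order_trans)
  then show "cmod (f z - f 0) * (1 - cmod z) \<le> 2 * cmod z * (1 - cmod (f 0))"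
    by (simp add: c_def p_def r_def algebra_simps)
qed

text \<open>With w the Moebius image of z, 1 - |w|^2 equals (1 - |a|^2)(1 - |z|^2) / |1 - cnj a
  z|^2, and the denominator is at most 4.\<close>

lemma Moebius_uniform_bound:
  assumes "A < 1" "r < 1"
  obtains B where "B < 1" "0 < B" "\<And>a z. cmod a \<le> A \<Longrightarrow> cmod z \<le> r \<Longrightarrow> cmod (Moebius_function 0 a z) \<le> B"
proof -
  \<comment> \<open>A or r may be negative, with a square exceeding 1; truncation keeps
    \<open>q\<close> positive.\<close>
  define A' r' where "A' = max A 0" and "r' = max r 0"
  define q where "q = (1 - A'\<^sup>2) * (1 - r'\<^sup>2) / 4"
  have A': "0 \<le> A'" "A' < 1" "A'\<^sup>2 < 1" and r': "0 \<le> r'" "r' < 1" "r'\<^sup>2 < 1"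
    using assms by (auto simp: A'_def r'_def power_less_one_iff abs_square_less_1)
  have q: "0 < q" "q < 1"
  proof -
    show "0 < q" using A' r' by (simp add: q_def)
    have "(1 - A'\<^sup>2) * (1 - r'\<^sup>2) \<le> 1 * 1" using A' r' by (intro mult_mono) auto
    then show "q < 1" by (simp add: q_def)
  qed
  show ?thesis
  proof (rule that[of "sqrt (1 - q)"])
    show "sqrt (1 - q) < 1" "0 < sqrt (1 - q)" using q by auto
    fix a z assume a: "cmod a \<le> A" and z: "cmod z \<le> r"
    have a1: "cmod a \<le> A'" "cmod a < 1" and z1: "cmod z \<le> r'" "cmod z < 1"
      using a z assms by (auto simp: A'_def r'_def)
    define D where "D = cmod (1 - cnj a * z)"
    have D: "0 < D" "D \<le> 2"
      using one_minus_cnj_mult_nonzero[of a z] cmod_one_minus_cnj_mult_le_2[of a z] a1 z1 by (auto simp: D_def)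
    have "4 * q \<le> (1 - (cmod a)\<^sup>2) * (1 - (cmod z)\<^sup>2)"
      unfolding q_def using a1 z1 A' r' power_mono[OF a1(1), of 2] power_mono[OF z1(1), of 2]
      by (auto intro!: mult_mono simp: power_le_one)
    also have "\<dots> = D\<^sup>2 - (cmod (z - a))\<^sup>2" by (simp add: D_def cmod_one_minus_cnj_mult_sq)
    finally have E: "4 * q \<le> D\<^sup>2 - (cmod (z - a))\<^sup>2" .
    have "q * D\<^sup>2 \<le> q * 4" using D power_mono[OF D(2), of 2] q by simp
    then have "(cmod (z - a))\<^sup>2 \<le> (1 - q) * D\<^sup>2" using E by (simp add: algebra_simps)
    then have "(cmod (z - a) / D)\<^sup>2 \<le> 1 - q" using D by (simp add: power_divide divide_simps)
    then show "cmod (Moebius_function 0 a z) \<le> sqrt (1 - q)"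
      by (simp add: Moebius_function_simple norm_divide D_def real_le_rsqrt)
  qed
qed

text \<open>Quantitative rigidity: a self-map fixing 0 and 1/2 is the identity. Linearity of the
  bound in the two displacements is what lets integral kernels at these points control a compact
  set.\<close>

lemma self_map_near_identity:
  assumes "r < 1"
  obtains C where "0 < C"
    "\<And>h z. \<lbrakk>h holomorphic_on ball 0 1; h ` ball 0 1 \<subseteq> ball 0 1; cmod z \<le> r\<rbrakk>
       \<Longrightarrow> cmod (h z - z) \<le> C * (cmod (h 0) + cmod (h (1/2) - 1/2))"
proof -
  obtain B where B: "B < 1" "0 < B" and BM: "\<And>a z. cmod a \<le> 1/2 \<Longrightarrow> cmod z \<le> r \<Longrightarrow> cmod (Moebius_function 0 a z) \<le> B"
    using Moebius_uniform_bound[of "1/2" r] assms by auto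
  show ?thesis
  proof (rule that[of "4 + 16 / (1 - B)"])
    show "0 < 4 + 16 / (1 - B)" using B by (simp add: add_pos_pos)
    fix h z assume holh: "h holomorphic_on ball 0 1" and him: "h ` ball 0 1 \<subseteq> ball 0 1" and z: "cmod z \<le> r"
    define a \<epsilon> where "a = h 0" and "\<epsilon> = cmod (h (1/2) - 1/2)"
    have h1: "cmod (h x) < 1" if "cmod x < 1" for x using him that by force
    have z1: "cmod z < 1" using z assms by simp
    have e0: "0 \<le> \<epsilon>" by (simp add: \<epsilon>_def)
    have a1: "cmod a < 1" using h1[of 0] by (simp add: a_def)
    show "cmod (h z - z) \<le> (4 + 16 / (1 - B)) * (cmod (h 0) + cmod (h (1/2) - 1/2))"
    proof (cases "cmod a \<ge> 1/2")
      case True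
      have "cmod (h z - z) \<le> 2" using norm_triangle_ineq4[of "h z" z] h1[OF z1] z1 by linarith
      also have "\<dots> \<le> 4 * (cmod a + \<epsilon>)" using True e0 by simp
      also have "\<dots> \<le> (4 + 16 / (1 - B)) * (cmod a + \<epsilon>)" using B e0 by (intro mult_right_mono) auto
      finally show ?thesis by (simp add: a_def \<epsilon>_def)
    next
      case False
      \<comment> \<open>Moving h(0) back to 0 costs at most 4|a| and makes the quotient by z
        available; closeness to the identity becomes closeness of that quotient to 1.\<close>
      define H where "H = Moebius_function 0 a \<circ> h"
      have holH: "H holomorphic_on ball 0 1" unfolding H_def
        by (intro holomorphic_on_compose_gen[of _ _ _ "ball 0 1"] Moebius_function_holomorphic holh him a1)
      have Him: "H ` ball 0 1 \<subseteq> ball 0 1" unfolding H_def using h1 a1 Moebius_function_norm_lt_1 by auto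
      have H0: "H 0 = 0" by (simp add: H_def a_def Moebius_function_eq_zero)
      have Hh: "cmod (H w - h w) \<le> 4 * cmod a" if "cmod w < 1" for w
      proof -
        have nz: "1 - cnj a * h w \<noteq> 0" using one_minus_cnj_mult_nonzero[of a "h w"] h1[OF that] a1 by simp
        have "H w - h w = (- a + cnj a * h w * h w) / (1 - cnj a * h w)"
          using nz by (simp add: H_def Moebius_function_simple divide_simps) (simp add: algebra_simps)
        moreover have "cmod (- a + cnj a * h w * h w) \<le> 2 * cmod a"
        proof -
          have "cmod (h w) * cmod (h w) \<le> 1 * 1" using h1[OF that] by (intro mult_mono) auto
          then have "cmod a * (cmod (h w) * cmod (h w)) \<le> cmod a" by (simp add: mult_left_le)
          then show ?thesis using norm_triangle_ineq[of "-a" "cnj a * h w * h w"] by (simp add: norm_mult mult.assoc)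
        qed
        moreover have "1/2 \<le> cmod (1 - cnj a * h w)"
        proof -
          have "cmod (cnj a * h w) \<le> 1/2 * 1" unfolding norm_mult using False h1[OF that] by (intro mult_mono) auto
          then show ?thesis using norm_triangle_ineq2[of 1 "cnj a * h w"] by simp
        qed
        ultimately have "cmod (H w - h w) \<le> (2 * cmod a) / (1/2)"
          by (simp only: norm_divide) (intro frac_le; simp)
        then show ?thesis by simp
      qed
      obtain p where p: "p holomorphic_on ball 0 1" "p ` ball 0 1 \<subseteq> cball 0 1" "\<And>z. cmod z < 1 \<Longrightarrow> H z = z * p z"
        using Schwarz_quotient[OF holH Him H0] by metis
      \<comment> \<open>\<open>e\<close> is controlled by hypothesis data, \<open>x\<close> is
        wanted. Schwarz-Pick for \<open>p\<close> between 1/2 and z has contraction factor B < 1, so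
        it bounds |p(z) - p(1/2)| by B(|x| + |e|); together with |x| <= |p(z) - p(1/2)| + |e| the
        term B|x| can be absorbed.\<close>
      define e x where "e = 1 - p (1/2)" and "x = 1 - p z"
      have e: "cmod e \<le> 2 * (\<epsilon> + 4 * cmod a)"
      proof -
        have "cmod (H (1/2) - 1/2) \<le> cmod (H (1/2) - h (1/2)) + \<epsilon>"
          unfolding \<epsilon>_def using norm_triangle_ineq[of "H (1/2) - h (1/2)" "h (1/2) - 1/2"] by simp
        also have "\<dots> \<le> 4 * cmod a + \<epsilon>" using Hh[of "1/2"] by simp
        finally have "cmod (H (1/2) - 1/2) \<le> 4 * cmod a + \<epsilon>" .
        moreover have "H (1/2) - 1/2 = - (e / 2)" using p(3)[of "1/2"] by (simp add: e_def field_simps)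
        ultimately show ?thesis by (simp add: norm_divide)
      qed
      have px: "cmod (1 - x) \<le> 1" using p(2) z1 by (auto simp: x_def image_subset_iff)
      have nz: "1 - cnj (1/2) * z \<noteq> 0" using one_minus_cnj_mult_nonzero[of "1/2" z] z1 by simp
      have "cmod (z - 1/2) / cmod (1 - cnj (1/2) * z) \<le> B"
        using BM[of "1/2" z] z by (simp add: Moebius_function_simple norm_divide)
      then have b: "cmod (z - 1/2) \<le> B * cmod (1 - cnj (1/2) * z)" using nz by (simp add: divide_simps)
      have "cmod (p z - p (1/2)) * cmod (1 - cnj (1/2) * z) \<le> cmod (z - 1/2) * cmod (1 - cnj (p (1/2)) * p z)"
        by (rule Schwarz_Pick[OF p(1,2) z1]) simp
      also have "\<dots> \<le> (B * cmod (1 - cnj (1/2) * z)) * cmod (1 - cnj (p (1/2)) * p z)"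
        by (rule mult_right_mono[OF b]) simp
      finally have "cmod (1 - cnj (1/2) * z) * cmod (p z - p (1/2)) \<le> cmod (1 - cnj (1/2) * z) * (B * cmod (1 - cnj (p (1/2)) * p z))"
        by (simp only: mult_ac)
      then have sp: "cmod (p z - p (1/2)) \<le> B * cmod (1 - cnj (p (1/2)) * p z)"
        by (rule mult_left_le_imp_le) (use nz in simp)
      have "1 - cnj (p (1/2)) * p z = x + cnj e * (1 - x)" by (simp add: e_def x_def algebra_simps)
      then have "cmod (1 - cnj (p (1/2)) * p z) \<le> cmod x + cmod e * cmod (1 - x)"
        using norm_triangle_ineq[of x "cnj e * (1 - x)"] by (simp add: norm_mult)
      also have "\<dots> \<le> cmod x + cmod e" using px by (simp add: mult_left_le)
      finally have "cmod (p z - p (1/2)) \<le> B * (cmod x + cmod e)" using sp B by (meson mult_left_mono order_trans less_imp_le)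
      moreover have "cmod x \<le> cmod (p z - p (1/2)) + cmod e"
      proof -
        have "x = e - (p z - p (1/2))" by (simp add: x_def e_def)
        then show ?thesis using norm_triangle_ineq4[of e "p z - p (1/2)"] by simp
      qed
      ultimately have "(1 - B) * cmod x \<le> B * cmod e + cmod e" by (simp add: algebra_simps)
      also have "\<dots> \<le> 2 * cmod e" using B mult_right_mono[of B 1 "cmod e"] by simp
      finally have x: "cmod x \<le> 2 * cmod e / (1 - B)" using B by (simp add: pos_le_divide_eq mult.commute)
      have "H z - z = - (z * x)" using p(3)[OF z1] by (simp add: x_def algebra_simps)
      then have "cmod (H z - z) \<le> cmod x" using z1 by (simp add: norm_mult mult_left_le_one_le)
      also have "\<dots> \<le> 2 * (2 * (\<epsilon> + 4 * cmod a)) / (1 - B)"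
        using x e B by (smt (verit) divide_right_mono)
      finally have "cmod (H z - z) \<le> 2 * (2 * (\<epsilon> + 4 * cmod a)) / (1 - B)" .
      moreover have "cmod (h z - z) \<le> cmod (H z - h z) + cmod (H z - z)"
        using norm_triangle_ineq4[of "H z - z" "H z - h z"] by simp
      ultimately have "cmod (h z - z) \<le> 4 * cmod a + 2 * (2 * (\<epsilon> + 4 * cmod a)) / (1 - B)" using Hh[OF z1] by linarith
      also have "\<dots> \<le> 4 * (cmod a + \<epsilon>) + 16 / (1 - B) * (cmod a + \<epsilon>)"
        using B e0 by (intro add_mono) (auto simp: divide_simps)
      finally show ?thesis by (simp add: a_def \<epsilon>_def distrib_right)
    qed
  qed
qed

section \<open>Lipschitz and covering estimates for holomorphic maps of the disk\<close>

lemma holomorphic_bounded_imp_Lipschitz: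
  assumes holf: "f holomorphic_on ball 0 1" and rR: "r < R" "R < 1"
    and B: "\<And>z. cmod z \<le> R \<Longrightarrow> cmod (f z) \<le> B" and z: "cmod z \<le> r" and w: "cmod w \<le> r"
  shows "cmod (f z - f w) \<le> B / (R - r) * cmod (z - w)"
proof (rule field_differentiable_bound[of "cball 0 r" f "deriv f"])
  show "convex (cball 0 r :: complex set)" by simp
  fix x :: complex assume "x \<in> cball 0 r"
  then have x: "cmod x \<le> r" by simp
  have x1: "x \<in> ball 0 1" using x rR by simp
  show "(f has_field_derivative deriv f x) (at x within cball 0 r)"
    using holomorphic_derivI[OF holf _ x1] by (simp add: has_field_derivative_at_within)
  have sub: "cball x (R - r) \<subseteq> cball 0 R" using x by (auto simp: dist_norm) (smt (verit) norm_triangle_sub norm_minus_commute)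
  have sub1: "cball 0 R \<subseteq> (ball 0 1 :: complex set)" using rR by auto
  have "cmod ((deriv ^^ 1) f x) \<le> fact 1 * B / (R - r) ^ 1"
  proof (rule Cauchy_inequality)
    show "f holomorphic_on ball x (R - r)" using holf sub sub1 ball_subset_cball holomorphic_on_subset by (metis order_trans)
    show "continuous_on (cball x (R - r)) f" using holf sub sub1 holomorphic_on_imp_continuous_on holomorphic_on_subset by (metis order_trans)
    show "0 < R - r" using rR by simp
    fix y assume "cmod (x - y) = R - r"
    then have "y \<in> cball x (R - r)" by (simp add: dist_norm)
    then show "cmod (f y) \<le> B" using sub B by auto
  qed
  then show "cmod (deriv f x) \<le> B / (R - r)" by simp
qed (use z w in auto)

text \<open>The sphere of radius \<rho> is mapped outside \<open>ball 0 m\<close>, so within that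
  ball the images of the open and of the closed \<rho>-disk agree. The trace is therefore open and
  closed in a connected set, and it contains 0.\<close>

lemma covers_ball_if_large_on_sphere:
  assumes holG: "G holomorphic_on ball 0 1" and G0: "G 0 = 0" and \<rho>: "0 < \<rho>" "\<rho> < 1" and m: "0 < m"
    and low: "\<And>z. cmod z = \<rho> \<Longrightarrow> m \<le> cmod (G z)"
  shows "ball 0 m \<subseteq> G ` ball 0 1"
proof -
  have cb: "cball 0 \<rho> \<subseteq> (ball 0 1 :: complex set)" using \<rho> by auto
  have bb: "ball 0 \<rho> \<subseteq> (ball 0 1 :: complex set)" using \<rho> by auto
  have nc: "\<not> G constant_on ball 0 1"
  proof
    assume "G constant_on ball 0 1"
    moreover have "0 \<in> ball 0 (1::real)" "complex_of_real \<rho> \<in> ball 0 1" "(0::complex) \<in> ball 0 1" using \<rho> by auto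
    ultimately have "G (complex_of_real \<rho>) = G 0" unfolding constant_on_def by metis
    then show False using low[of "complex_of_real \<rho>"] G0 \<rho> m by simp
  qed
  have op: "open (G ` ball 0 \<rho>)"
    by (rule open_mapping_thm[OF holG _ _ _ bb nc]) auto
  have cl: "closed (G ` cball 0 \<rho>)"
    using holG cb by (intro compact_imp_closed compact_continuous_image) (auto intro: holomorphic_on_imp_continuous_on holomorphic_on_subset)
  have eq: "ball 0 m \<inter> G ` cball 0 \<rho> = ball 0 m \<inter> G ` ball 0 \<rho>"
  proof -
    have "x \<in> ball 0 \<rho>" if "x \<in> cball 0 \<rho>" "G x \<in> ball 0 m" for x
      using that low[of x] by fastforce
    then show ?thesis using ball_subset_cball[of 0 \<rho>] by blast
  qed
  have "connected (ball (0::complex) m)" by simp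
  then have "ball 0 m \<inter> G ` ball 0 \<rho> = {} \<or> ball 0 m \<inter> G ` ball 0 \<rho> = ball 0 m"
    unfolding connected_clopen
    using op cl eq by (metis closedin_closed_Int openin_open_Int)
  moreover have "0 \<in> ball 0 m \<inter> G ` ball 0 \<rho>" using G0 m \<rho> by (auto intro: rev_image_eqI)
  ultimately have "ball 0 m \<subseteq> G ` ball 0 \<rho>" by blast
  then show ?thesis using bb by blast
qed

lemma compact_subset_ball_imp_subset_cball:
  fixes K :: "'a::real_normed_vector set"
  assumes "compact K" "K \<subseteq> ball 0 1"
  obtains r where "r < 1" "K \<subseteq> cball 0 r"
proof (cases "K = {}")
  case False
  obtain x where "x \<in> K" "\<And>y. y \<in> K \<Longrightarrow> norm y \<le> norm x"
    using continuous_attains_sup[OF assms(1) False, of norm] by (auto intro: continuous_intros)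
  then show ?thesis using assms(2) by (intro that[of "norm x"]) auto
qed (use that[of 0] in auto)

subsection \<open>Evolution families fixing the origin\<close>

text \<open>Induction on the number of factors q by which w may drop. When the drop exceeds one
  factor, the intermediate value theorem supplies a time v with w v = q w t exactly, which uses up
  one factor. \<open>P\<close> is abstract because both a multiplicative and an additive estimate
  are propagated this way.\<close>

lemma continuous_decay_chain:
  fixes w :: "real \<Rightarrow> real"
  assumes cont: "continuous_on {a..} w" and pos: "\<And>t. a \<le> t \<Longrightarrow> 0 < w t" and q: "0 < q" "q < 1"
    and trans: "\<And>t v u. \<lbrakk>a \<le> t; t \<le> v; v \<le> u; P t v; P v u\<rbrakk> \<Longrightarrow> P t u"
    and step: "\<And>t u. \<lbrakk>a \<le> t; t \<le> u; q * w t \<le> w u\<rbrakk> \<Longrightarrow> P t u"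
    and tu: "a \<le> t" "t \<le> u"
  shows "P t u"
proof -
  have main: "P t u" if "q ^ n * w t \<le> w u" "a \<le> t" "t \<le> u" for n t
    using that
  proof (induction n arbitrary: t)
    case 0
    have "q * w t \<le> 1 * w t" using pos[of t] q 0 by (intro mult_right_mono) auto
    then show ?case using 0 by (intro step) auto
  next
    case (Suc n)
    show ?case
    proof (cases "q * w t \<le> w u")
      case True
      then show ?thesis using step Suc.prems by blast
    next
      case False
      have "q * w t \<le> w t" using pos[of t] q Suc.prems by (intro mult_left_le_one_le) auto
      moreover have "continuous_on {t..u} w" using cont Suc.prems by (rule_tac continuous_on_subset) auto
      ultimately obtain v where v: "t \<le> v" "v \<le> u" "w v = q * w t"
        using IVT2'[of w u "q * w t" t] False Suc.prems by auto
      then have "P v u" using Suc.prems by (intro Suc.IH) (auto simp: mult_ac)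
      moreover have "P t v" using v Suc.prems by (intro step) auto
      ultimately show ?thesis using trans v Suc.prems by blast
    qed
  qed
  obtain n where "q ^ n < w u / w t" using real_arch_pow_inv[of "w u / w t" q] q pos[of t] pos[of u] tu by auto
  then have "q ^ n * w t \<le> w u" using pos[of t] tu by (simp add: field_simps)
  then show ?thesis using main tu by blast
qed

locale radial_family =
  fixes \<psi> :: "real \<Rightarrow> real \<Rightarrow> complex \<Rightarrow> complex"
  assumes hol: "\<And>s t. \<lbrakk>0 \<le> s; s \<le> t\<rbrakk> \<Longrightarrow> \<psi> s t holomorphic_on ball 0 1"
    and into: "\<And>s t. \<lbrakk>0 \<le> s; s \<le> t\<rbrakk> \<Longrightarrow> \<psi> s t ` ball 0 1 \<subseteq> ball 0 1"
    and inj: "\<And>s t. \<lbrakk>0 \<le> s; s \<le> t\<rbrakk> \<Longrightarrow> inj_on (\<psi> s t) (ball 0 1)"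
    and zero: "\<And>s t. \<lbrakk>0 \<le> s; s \<le> t\<rbrakk> \<Longrightarrow> \<psi> s t 0 = 0"
    and refl: "\<And>s z. \<lbrakk>0 \<le> s; cmod z < 1\<rbrakk> \<Longrightarrow> \<psi> s s z = z"
    and comp: "\<And>s u t z. \<lbrakk>0 \<le> s; s \<le> u; u \<le> t; cmod z < 1\<rbrakk> \<Longrightarrow> \<psi> s t z = \<psi> u t (\<psi> s u z)"
    and cont: "continuous_on {0..} (\<lambda>t. \<psi> 0 t (1/2))"
begin

definition c :: "real \<Rightarrow> real \<Rightarrow> complex" where "c s t = deriv (\<psi> s t) 0"

lemma norm_less: "\<lbrakk>0 \<le> s; s \<le> t; cmod z < 1\<rbrakk> \<Longrightarrow> cmod (\<psi> s t z) < 1"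
  using into by (force simp: image_subset_iff)

lemma norm_le: "\<lbrakk>0 \<le> s; s \<le> t; cmod z < 1\<rbrakk> \<Longrightarrow> cmod (\<psi> s t z) \<le> cmod z"
  by (rule Schwarz_Lemma(1)[OF hol zero norm_less])

lemma c_nonzero: "\<lbrakk>0 \<le> s; s \<le> t\<rbrakk> \<Longrightarrow> c s t \<noteq> 0"
  unfolding c_def using holomorphic_injective_imp_regular[OF hol _ inj, of s t 0] by simp

lemma c_norm_le_1: "\<lbrakk>0 \<le> s; s \<le> t\<rbrakk> \<Longrightarrow> cmod (c s t) \<le> 1"
  unfolding c_def by (rule Schwarz_Lemma(2)[OF hol zero norm_less, where \<xi>=0]) auto

lemma c_mult:
  assumes "0 \<le> s" "s \<le> u" "u \<le> t"
  shows "c s t = c u t * c s u"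
proof -
  have su: "\<psi> s u field_differentiable at 0" and ut: "\<psi> u t field_differentiable at (\<psi> s u 0)"
    using hol assms zero by (auto intro: holomorphic_on_imp_differentiable_at[of _ "ball 0 1"])
  have "eventually (\<lambda>z::complex. z \<in> ball 0 1) (nhds 0)" by (intro eventually_nhds_in_open) auto
  then have "eventually (\<lambda>z. \<psi> s t z = (\<psi> u t \<circ> \<psi> s u) z) (nhds 0)"
    by eventually_elim (simp add: comp[OF assms])
  then have "deriv (\<psi> s t) 0 = deriv (\<psi> u t \<circ> \<psi> s u) 0" by (rule deriv_cong_ev) simp
  also have "\<dots> = deriv (\<psi> u t) (\<psi> s u 0) * deriv (\<psi> s u) 0" by (rule deriv_chain[OF su ut])
  finally show ?thesis using zero assms by (simp add: c_def)
qed

lemma quotient: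
  assumes "0 \<le> s" "s \<le> t"
  obtains p where "p holomorphic_on ball 0 1" "p ` ball 0 1 \<subseteq> cball 0 1" "p 0 = c s t"
    "\<And>z. cmod z < 1 \<Longrightarrow> \<psi> s t z = z * p z"
  unfolding c_def using Schwarz_quotient[OF hol into zero] assms by blast

text \<open>Writing \<psi>(\<zeta>) = \<zeta> p(\<zeta>), the left side is |\<zeta>| |p(\<zeta>) -
  p(0)| / |p(0)|. The oscillation of p is bounded by 1 - |p(0)|, that by 1 - |p(\<zeta>)|, and
  |\<zeta>|(1 - |p(\<zeta>)|) is exactly the loss of modulus, which telescopes. The constant is 2 *
  4 from the two estimates and 2 from 1/|c|.\<close>

lemma step_bound:
  assumes "0 \<le> t" "t \<le> u" "1/2 \<le> cmod (c t u)" "cmod \<zeta> \<le> r" "r < 1"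
  shows "cmod (\<psi> t u \<zeta> / c t u - \<zeta>) \<le> 16 / (1 - r)\<^sup>2 * cmod \<zeta> * (cmod \<zeta> - cmod (\<psi> t u \<zeta>))"
proof -
  obtain p where p: "p holomorphic_on ball 0 1" "p ` ball 0 1 \<subseteq> cball 0 1" "p 0 = c t u"
    "\<And>z. cmod z < 1 \<Longrightarrow> \<psi> t u z = z * p z"
    using quotient[of t u] assms by auto
  define x where "x = cmod \<zeta>"
  have x: "0 \<le> x" "x \<le> r" "x < 1" using assms by (auto simp: x_def)
  have z1: "cmod \<zeta> < 1" using assms by simp
  have p1: "cmod (p \<zeta>) \<le> 1" using p(2) z1 by (auto simp: image_subset_iff)
  have cl: "cmod (c t u) \<le> 1" using c_norm_le_1 assms by simp
  define \<delta> where "\<delta> = 1 - cmod (c t u)"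
  have d0: "0 \<le> \<delta>" using cl by (simp add: \<delta>_def)
  have A: "cmod (p \<zeta> - c t u) * (1 - x) \<le> 2 * x * \<delta>"
    using Schwarz_Pick_origin(3)[OF p(1,2) z1] p(3) by (simp add: x_def \<delta>_def)
  have B: "\<delta> * (1 - x\<^sup>2) \<le> 4 * (1 - cmod (p \<zeta>))"
    using Schwarz_Pick_origin(1)[OF p(1,2) z1] p(3) by (simp add: x_def \<delta>_def)
  have "cmod (p \<zeta> - c t u) * (1 - r) \<le> cmod (p \<zeta> - c t u) * (1 - x)" using x by (intro mult_left_mono) auto
  then have A': "cmod (p \<zeta> - c t u) * (1 - r) \<le> 2 * x * \<delta>" using A by simp
  have "x\<^sup>2 \<le> r" using x by (smt (verit) mult_left_le power2_eq_square)
  then have "\<delta> * (1 - r) \<le> \<delta> * (1 - x\<^sup>2)" using d0 by (intro mult_left_mono) auto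
  then have B': "\<delta> * (1 - r) \<le> 4 * (1 - cmod (p \<zeta>))" using B by simp
  have "cmod (p \<zeta> - c t u) * (1 - r)\<^sup>2 \<le> 2 * x * \<delta> * (1 - r)"
    using mult_right_mono[OF A', of "1 - r"] assms(5) by (simp add: power2_eq_square mult.assoc)
  also have "\<dots> \<le> 2 * x * (4 * (1 - cmod (p \<zeta>)))"
    using mult_left_mono[OF B', of "2 * x"] x by (simp add: mult.assoc)
  finally have C: "cmod (p \<zeta> - c t u) \<le> 8 * (x * (1 - cmod (p \<zeta>))) / (1 - r)\<^sup>2"
    using assms(5) by (simp add: pos_le_divide_eq algebra_simps)
  have "\<psi> t u \<zeta> / c t u - \<zeta> = \<zeta> * (p \<zeta> - c t u) / c t u"
    using p(4)[OF z1] c_nonzero assms by (simp add: field_simps)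
  then have "cmod (\<psi> t u \<zeta> / c t u - \<zeta>) = x * cmod (p \<zeta> - c t u) / cmod (c t u)"
    by (simp add: norm_mult norm_divide x_def)
  also have "\<dots> \<le> x * cmod (p \<zeta> - c t u) / (1/2)" using assms x by (intro divide_left_mono) auto
  also have "\<dots> \<le> x * (8 * (x * (1 - cmod (p \<zeta>))) / (1 - r)\<^sup>2) / (1/2)"
    using C x by (intro divide_right_mono mult_left_mono) auto
  also have "\<dots> = 16 / (1 - r)\<^sup>2 * x * (x - cmod (\<psi> t u \<zeta>))"
    using p(4)[OF z1] by (simp add: norm_mult x_def algebra_simps)
  finally show ?thesis by (simp add: x_def)
qed

text \<open>
  The decay of \<open>\<psi> 0 t (1/2)\<close>, continuous in \<open>t\<close> by assumption, controls the derivative \<open>c t u\<close> at the origin,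
  so no continuity of \<open>c\<close> is required.
\<close>
lemma chain:
  assumes trans: "\<And>t v u. \<lbrakk>s \<le> t; t \<le> v; v \<le> u; P t v; P v u\<rbrakk> \<Longrightarrow> P t u"
    and step: "\<And>t u. \<lbrakk>s \<le> t; t \<le> u; 1/2 \<le> cmod (c t u)\<rbrakk> \<Longrightarrow> P t u"
    and s: "0 \<le> s" "s \<le> t" "t \<le> u"
  shows "P t u"
\<comment> \<open>The ratio 29/32 solves 4(1 - q) = (3/4)(1/2): the orbit of 1/2 stays in |w| <=
  1/2, so 1 - |w|^2 >= 3/4, and a smaller drop forces 1 - |c t u| <= 1/2.\<close>
proof (rule continuous_decay_chain[of s "\<lambda>t. cmod (\<psi> 0 t (1/2))" "29/32" P])
  show "continuous_on {s..} (\<lambda>t. cmod (\<psi> 0 t (1 / 2)))"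
    using s by (intro continuous_on_norm continuous_on_subset[OF cont]) auto
  have pos: "0 < cmod (\<psi> 0 t (1/2))" if "0 \<le> t" for t
    using inj_onD[OF inj[of 0 t], of "1/2" 0] zero[of 0 t] that by auto
  then show "0 < cmod (\<psi> 0 t (1/2))" if "s \<le> t" for t using that s by auto
  fix t u assume tu: "s \<le> t" "t \<le> u" and q: "29/32 * cmod (\<psi> 0 t (1/2)) \<le> cmod (\<psi> 0 u (1/2))"
  define w where "w = \<psi> 0 t (1/2)"
  have w: "cmod w \<le> 1/2" "0 < cmod w" using norm_le[of 0 t "1/2"] pos[of t] tu s by (auto simp: w_def)
  obtain p where p: "p holomorphic_on ball 0 1" "p ` ball 0 1 \<subseteq> cball 0 1" "p 0 = c t u"
    "\<And>z. cmod z < 1 \<Longrightarrow> \<psi> t u z = z * p z"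
    using quotient[of t u] tu s by auto
  have "\<psi> 0 u (1/2) = w * p w" using comp[of 0 t u "1/2"] p(4)[of w] tu s w by (simp add: w_def)
  then have "cmod w * (29/32) \<le> cmod w * cmod (p w)" using q by (simp add: norm_mult w_def)
  then have pw: "29/32 \<le> cmod (p w)" using w by (simp only: mult_le_cancel_left_pos)
  have "(1 - cmod (c t u)) * (1 - (cmod w)\<^sup>2) \<le> 4 * (1 - cmod (p w))"
    using Schwarz_Pick_origin(1)[OF p(1,2), of w] w p(3) by simp
  moreover have "(cmod w)\<^sup>2 \<le> 1/4" using power_mono[OF w(1), of 2] by (simp add: power_divide)
  moreover have "(1 - cmod (c t u)) * (3/4) \<le> (1 - cmod (c t u)) * (1 - (cmod w)\<^sup>2)"
    using calculation c_norm_le_1[of t u] tu s by (intro mult_left_mono) auto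
  ultimately have "1/2 \<le> cmod (c t u)" using pw by simp
  then show "P t u" using step tu by blast
qed (use assms in auto)

section \<open>Bounds on the normalized maps, uniform in the end time\<close>

definition F :: "real \<Rightarrow> real \<Rightarrow> complex \<Rightarrow> complex" where "F s t z = \<psi> s t z / c s t"

text \<open>\<open>step_bound\<close> at the point \<open>\<psi> s t z\<close>, divided by
  \<open>c s t\<close>. The factor |\<zeta>| kept there becomes |F s t z|, so the increment is
  relative to the current value.\<close>

lemma F_step:
  assumes "0 \<le> s" "s \<le> t" "t \<le> u" "1/2 \<le> cmod (c t u)" "cmod z \<le> r" "r < 1"
  shows "cmod (F s u z - F s t z) \<le> 16 / (1 - r)\<^sup>2 * cmod (F s t z) * (cmod (\<psi> s t z) - cmod (\<psi> s u z))"
proof -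
  have z1: "cmod z < 1" using assms by simp
  have "cmod (\<psi> s t z) \<le> r" using norm_le[of s t z] assms by simp
  then have A: "cmod (\<psi> t u (\<psi> s t z) / c t u - \<psi> s t z)
      \<le> 16 / (1 - r)\<^sup>2 * cmod (\<psi> s t z) * (cmod (\<psi> s t z) - cmod (\<psi> t u (\<psi> s t z)))"
    using step_bound[of t u "\<psi> s t z" r] assms by auto
  have eq: "\<psi> t u (\<psi> s t z) = \<psi> s u z" using comp[of s t u z] assms z1 by simp
  have "F s u z - F s t z = (\<psi> t u (\<psi> s t z) / c t u - \<psi> s t z) / c s t"
    using c_mult[of s t u] c_nonzero[of s t] c_nonzero[of t u] assms by (simp add: F_def eq field_simps)
  then have "cmod (F s u z - F s t z) = cmod (\<psi> t u (\<psi> s t z) / c t u - \<psi> s t z) / cmod (c s t)"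
    by (simp add: norm_divide)
  also have "\<dots> \<le> 16 / (1 - r)\<^sup>2 * cmod (\<psi> s t z) * (cmod (\<psi> s t z) - cmod (\<psi> t u (\<psi> s t z))) / cmod (c s t)"
    using A by (rule divide_right_mono) simp
  finally show ?thesis by (simp add: F_def norm_divide eq)
qed

text \<open>Each step multiplies |F| by at most 1 + K * drop, hence by at most exp(K * drop); the
  exponents telescope to at most K|z|.\<close>

lemma F_bound:
  assumes "0 \<le> s" "s \<le> t" "cmod z \<le> r" "r < 1"
  shows "cmod (F s t z) \<le> exp (16 / (1 - r)\<^sup>2)"
proof -
  define K where "K = 16 / (1 - r)\<^sup>2"
  have K: "0 \<le> K" by (simp add: K_def)
  have "cmod (F s t z) \<le> cmod (F s s z) * exp (K * (cmod (\<psi> s s z) - cmod (\<psi> s t z)))"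
  proof (rule chain[of s "\<lambda>t u. cmod (F s u z) \<le> cmod (F s t z) * exp (K * (cmod (\<psi> s t z) - cmod (\<psi> s u z)))"])
    fix t v u
    assume 1: "cmod (F s v z) \<le> cmod (F s t z) * exp (K * (cmod (\<psi> s t z) - cmod (\<psi> s v z)))"
      and 2: "cmod (F s u z) \<le> cmod (F s v z) * exp (K * (cmod (\<psi> s v z) - cmod (\<psi> s u z)))"
    have "cmod (F s u z) \<le> cmod (F s t z) * exp (K * (cmod (\<psi> s t z) - cmod (\<psi> s v z))) * exp (K * (cmod (\<psi> s v z) - cmod (\<psi> s u z)))"
      by (rule order_trans[OF 2 mult_right_mono[OF 1]]) simp
    also have "\<dots> = cmod (F s t z) * exp (K * (cmod (\<psi> s t z) - cmod (\<psi> s u z)))"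
      by (simp add: mult.assoc flip: exp_add) (simp add: algebra_simps)
    finally show "cmod (F s u z) \<le> \<dots>" .
  next
    fix t u assume tu: "s \<le> t" "t \<le> u" "1/2 \<le> cmod (c t u)"
    let ?x = "K * (cmod (\<psi> s t z) - cmod (\<psi> s u z))"
    have "cmod (F s u z) \<le> cmod (F s t z) + cmod (F s u z - F s t z)" by (metis norm_triangle_sub)
    also have "\<dots> \<le> cmod (F s t z) * (1 + ?x)"
      using F_step[of s t u z r] assms tu by (simp add: K_def algebra_simps)
    also have "\<dots> \<le> cmod (F s t z) * exp ?x" by (intro mult_left_mono exp_ge_add_one_self) simp
    finally show "cmod (F s u z) \<le> cmod (F s t z) * exp ?x" .
  qed (use assms in auto)
  also have "\<dots> \<le> 1 * exp (K * 1)"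
  proof (intro mult_mono)
    have z: "\<psi> s s z = z" using refl assms by simp
    \<comment> \<open>An idempotent nonzero number is 1, which avoids differentiating
      \<open>\<psi> s s\<close>.\<close>
    have "c s s * c s s = c s s" using c_mult[of s s s] assms by simp
    then have "c s s = 1" using c_nonzero[of s s] assms by simp
    then show "cmod (F s s z) \<le> 1" using z assms by (simp add: F_def)
    have "cmod (\<psi> s s z) - cmod (\<psi> s t z) \<le> 1"
      unfolding z using assms norm_ge_zero[of "\<psi> s t z"] by linarith
    then show "exp (K * (cmod (\<psi> s s z) - cmod (\<psi> s t z))) \<le> exp (K * 1)"
      using K mult_left_mono by (simp only: exp_le_cancel_iff) blast
  qed auto
  finally show ?thesis by (simp add: K_def)
qed

text \<open>Once |F| is bounded by exp K, the relative step estimate becomes absolute and its right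
  side telescopes. Convergence of the decreasing quantity |\<psi> s t z| then yields convergence of
  F.\<close>

lemma F_diff:
  assumes "0 \<le> s" "s \<le> t" "t \<le> u" "cmod z \<le> r" "r < 1"
  shows "cmod (F s u z - F s t z)
    \<le> 16 / (1 - r)\<^sup>2 * exp (16 / (1 - r)\<^sup>2) * (cmod (\<psi> s t z) - cmod (\<psi> s u z))"
proof -
  define K where "K = 16 / (1 - r)\<^sup>2"
  have K: "0 \<le> K" by (simp add: K_def)
  have "cmod (F s u z - F s t z) \<le> K * exp K * (cmod (\<psi> s t z) - cmod (\<psi> s u z))"
  proof (rule chain[of s "\<lambda>t u. cmod (F s u z - F s t z) \<le> K * exp K * (cmod (\<psi> s t z) - cmod (\<psi> s u z))"])
    fix t v u
    assume 1: "cmod (F s v z - F s t z) \<le> K * exp K * (cmod (\<psi> s t z) - cmod (\<psi> s v z))"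
      and 2: "cmod (F s u z - F s v z) \<le> K * exp K * (cmod (\<psi> s v z) - cmod (\<psi> s u z))"
    have "cmod (F s u z - F s t z) \<le> cmod (F s u z - F s v z) + cmod (F s v z - F s t z)"
      using norm_triangle_ineq[of "F s u z - F s v z" "F s v z - F s t z"] by simp
    then show "cmod (F s u z - F s t z) \<le> K * exp K * (cmod (\<psi> s t z) - cmod (\<psi> s u z))"
      using 1 2 by (simp add: algebra_simps)
  next
    fix t u assume tu: "s \<le> t" "t \<le> u" "1/2 \<le> cmod (c t u)"
    have z: "cmod (\<psi> s t z) < 1" using norm_less[of s t z] assms tu by simp
    have "\<psi> s u z = \<psi> t u (\<psi> s t z)" using comp[of s t u z] assms tu by simp
    then have d: "0 \<le> cmod (\<psi> s t z) - cmod (\<psi> s u z)" using norm_le[OF _ _ z, of t u] assms tu by simp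
    have "cmod (F s u z - F s t z) \<le> K * cmod (F s t z) * (cmod (\<psi> s t z) - cmod (\<psi> s u z))"
      using F_step[of s t u z r] assms tu by (simp add: K_def)
    also have "\<dots> \<le> K * exp K * (cmod (\<psi> s t z) - cmod (\<psi> s u z))"
      using d K F_bound[of s t z r] assms tu by (intro mult_right_mono mult_left_mono) (auto simp: K_def)
    finally show "cmod (F s u z - F s t z) \<le> K * exp K * (cmod (\<psi> s t z) - cmod (\<psi> s u z))" .
  qed (use assms in auto)
  then show ?thesis by (simp add: K_def)
qed

section \<open>The limit maps and their univalence\<close>

text \<open>Every s uses the same divisor \<open>c 0 n\<close>, which makes the limits compatible
  with \<psi>. Integer times suit the sequential theorems of Montel and Hurwitz; the terms with n <
  s are unspecified and do not affect the limit.\<close>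

definition g :: "real \<Rightarrow> complex \<Rightarrow> complex" where
  "g s z = lim (\<lambda>n. \<psi> s (real n) z / c 0 (real n))"

lemma ratio_eq_F: "\<lbrakk>0 \<le> s; s \<le> t\<rbrakk> \<Longrightarrow> \<psi> s t z / c 0 t = F s t z / c 0 s"
  using c_mult[of 0 s t] c_nonzero[of s t] by (simp add: F_def)

lemma antimono_norm: "\<lbrakk>0 \<le> s; s \<le> t; t \<le> u; cmod z < 1\<rbrakk> \<Longrightarrow> cmod (\<psi> s u z) \<le> cmod (\<psi> s t z)"
  using comp[of s t u z] norm_le[OF _ _ norm_less, of t u s t z] by simp

lemma g_LIMSEQ:
  assumes s: "0 \<le> s" and z: "cmod z < 1"
  shows "(\<lambda>n. \<psi> s (real n) z / c 0 (real n)) \<longlonglongrightarrow> g s z"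
proof -
  define N where "N = nat \<lceil>s\<rceil>"
  have N: "s \<le> real (n + N)" for n unfolding N_def by linarith
  define L where "L = 16 / (1 - cmod z)\<^sup>2 * exp (16 / (1 - cmod z)\<^sup>2)"
  define x where "x n = cmod (\<psi> s (real (n + N)) z)" for n
  have L: "0 \<le> L" by (simp add: L_def)
  have dec: "decseq x" unfolding x_def using N s z by (intro decseq_SucI antimono_norm) auto
  then have "convergent x"
    by (rule decseq_convergent[of x 0]) (auto simp: x_def convergent_def)
  then have "Cauchy x" by (rule convergent_Cauchy)
  have "Cauchy (\<lambda>n. F s (real (n + N)) z)"
  proof (rule CauchyI')
    fix e :: real assume e: "0 < e"
    then have "0 < e / (L + 1)" using L by simp
    then obtain M where M: "\<And>m n. m \<ge> M \<Longrightarrow> n \<ge> M \<Longrightarrow> \<bar>x m - x n\<bar> < e / (L + 1)"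
      using CauchyD[OF \<open>Cauchy x\<close>] by (metis real_norm_def)
    show "\<exists>M. \<forall>m\<ge>M. \<forall>n>m. dist (F s (real (m + N)) z) (F s (real (n + N)) z) < e"
    proof (intro exI allI impI)
      fix m n assume mn: "m \<ge> M" "n > m"
      have "norm (F s (real (n + N)) z - F s (real (m + N)) z) \<le> L * (x m - x n)"
        unfolding L_def x_def using mn N s z by (intro F_diff) auto
      also have "\<dots> \<le> (L + 1) * \<bar>x m - x n\<bar>" using L mn decseqD[OF dec, of m n] by (intro mult_mono) auto
      also have "\<dots> < (L + 1) * (e / (L + 1))" using M[of m n] mn L by (intro mult_strict_left_mono) auto
      finally show "dist (F s (real (m + N)) z) (F s (real (n + N)) z) < e"
        using L by (simp add: dist_norm norm_minus_commute)
    qed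
  qed
  then obtain l where "(\<lambda>n. F s (real (n + N)) z) \<longlonglongrightarrow> l" using Cauchy_convergent_iff convergent_def by blast
  then have "(\<lambda>n. F s (real (n + N)) z / c 0 s) \<longlonglongrightarrow> l / c 0 s"
    using c_nonzero[of 0 s] s by (intro tendsto_divide) auto
  then have "(\<lambda>n. \<psi> s (real (n + N)) z / c 0 (real (n + N))) \<longlonglongrightarrow> l / c 0 s"
    by (simp only: ratio_eq_F[OF s N])
  then have "(\<lambda>n. \<psi> s (real n) z / c 0 (real n)) \<longlonglongrightarrow> l / c 0 s" by (rule LIMSEQ_offset)
  then show ?thesis unfolding g_def by (simp add: limI)
qed

lemma g_comp:
  assumes "0 \<le> s" "s \<le> t" "cmod z < 1"
  shows "g t (\<psi> s t z) = g s z"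
proof (rule LIMSEQ_unique)
  show "(\<lambda>n. \<psi> s (real n) z / c 0 (real n)) \<longlonglongrightarrow> g s z" using g_LIMSEQ assms by simp
  have "(\<lambda>n. \<psi> t (real n) (\<psi> s t z) / c 0 (real n)) \<longlonglongrightarrow> g t (\<psi> s t z)"
    using g_LIMSEQ norm_less assms by simp
  moreover have "eventually (\<lambda>n. \<psi> t (real n) (\<psi> s t z) / c 0 (real n) = \<psi> s (real n) z / c 0 (real n)) sequentially"
    using eventually_ge_at_top[of "nat \<lceil>t\<rceil>"]
  proof eventually_elim
    case (elim n)
    then have "t \<le> real n" by linarith
    then show ?case using comp[of s t "real n" z] assms by simp
  qed
  ultimately show "(\<lambda>n. \<psi> s (real n) z / c 0 (real n)) \<longlonglongrightarrow> g t (\<psi> s t z)"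
    by (rule Lim_transform_eventually)
qed

lemma g_bound:
  assumes "0 \<le> s" "cmod z \<le> r" "r < 1"
  shows "cmod (g s z) \<le> exp (16 / (1 - r)\<^sup>2) / cmod (c 0 s)"
proof (rule LIMSEQ_le_const2)
  show "(\<lambda>n. cmod (\<psi> s (real n) z / c 0 (real n))) \<longlonglongrightarrow> cmod (g s z)"
    using assms by (intro tendsto_norm g_LIMSEQ) auto
  show "\<exists>N. \<forall>n\<ge>N. cmod (\<psi> s (real n) z / c 0 (real n)) \<le> exp (16 / (1 - r)\<^sup>2) / cmod (c 0 s)"
  proof (intro exI allI impI)
    fix n assume "n \<ge> nat \<lceil>s\<rceil>"
    then have n: "s \<le> real n" by linarith
    show "cmod (\<psi> s (real n) z / c 0 (real n)) \<le> exp (16 / (1 - r)\<^sup>2) / cmod (c 0 s)"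
      unfolding ratio_eq_F[OF assms(1) n] norm_divide
      using F_bound[OF assms(1) n assms(2,3)] by (rule divide_right_mono) simp
  qed
qed

text \<open>Pointwise convergence is already known, so any locally uniform limit of a subsequence
  provided by Montel must be \<open>g s\<close>. Derivatives at 0 converge along it and are
  constantly 1 / c 0 s, which rules out a constant limit and lets Hurwitz transfer
  injectivity.\<close>

lemma g_properties:
  assumes s: "0 \<le> s"
  shows g_holomorphic: "g s holomorphic_on ball 0 1" and g_inj: "inj_on (g s) (ball 0 1)"
    and g_deriv: "deriv (g s) 0 = 1 / c 0 s" and g_nonconst: "\<not> g s constant_on ball 0 1"
proof -
  define N where "N = nat \<lceil>s\<rceil>"
  have N: "s \<le> real (n + N)" for n unfolding N_def by linarith
  define H where "H n z = \<psi> s (real (n + N)) z / c 0 (real (n + N))" for n z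
  have nz: "c 0 (real (n + N)) \<noteq> 0" for n using c_nonzero by simp
  have holH: "H n holomorphic_on ball 0 1" for n
    unfolding H_def[abs_def] using hol[OF s N] nz by (intro holomorphic_intros) auto
  obtain h r where h: "h holomorphic_on ball 0 1" "strict_mono (r :: nat \<Rightarrow> nat)"
    "\<And>x. x \<in> ball 0 1 \<Longrightarrow> (\<lambda>n. H (r n) x) \<longlonglongrightarrow> h x"
    "\<And>K. \<lbrakk>compact K; K \<subseteq> ball 0 1\<rbrakk> \<Longrightarrow> uniform_limit K (H \<circ> r) h sequentially"
  proof (rule Montel[of "ball 0 1" "range H" H])
    fix K :: "complex set" assume K: "compact K" "K \<subseteq> ball 0 1"
    obtain \<rho> where \<rho>: "\<rho> < 1" "K \<subseteq> cball 0 \<rho>"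
      using compact_subset_ball_imp_subset_cball[OF K] by blast
    have "cmod (H n z) \<le> exp (16 / (1 - \<rho>)\<^sup>2) / cmod (c 0 s)" if "z \<in> K" for n z
      unfolding H_def ratio_eq_F[OF s N] norm_divide using that \<rho>
      by (intro divide_right_mono F_bound[OF s N]) auto
    then show "\<exists>B. \<forall>h\<in>range H. \<forall>z\<in>K. cmod (h z) \<le> B" by blast
  qed (use holH in auto)
  have gh: "g s z = h z" if "z \<in> ball 0 1" for z
  proof (rule LIMSEQ_unique)
    show "(\<lambda>n. H (r n) z) \<longlonglongrightarrow> h z" using h(3) that .
    have "(\<lambda>n. H n z) \<longlonglongrightarrow> g s z"
      unfolding H_def using that s by (intro LIMSEQ_ignore_initial_segment g_LIMSEQ) auto
    then show "(\<lambda>n. H (r n) z) \<longlonglongrightarrow> g s z" using LIMSEQ_subseq_LIMSEQ[OF _ h(2)] by (simp add: o_def)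
  qed
  show holg: "g s holomorphic_on ball 0 1" by (rule holomorphic_transform[OF h(1)]) (simp add: gh)
  have ul: "uniform_limit K (H \<circ> r) (g s) sequentially" if "compact K" "K \<subseteq> ball 0 1" for K
  proof -
    have "uniform_limit K (H \<circ> r) h sequentially \<longleftrightarrow> uniform_limit K (H \<circ> r) (g s) sequentially"
      using gh that by (intro uniform_limit_cong') auto
    then show ?thesis using h(4) that by blast
  qed
  have "(\<lambda>n. deriv ((H \<circ> r) n) 0) \<longlonglongrightarrow> deriv (g s) 0"
  proof (rule deriv_complex_uniform_limit)
    show "uniform_limit (ball 0 (1/2)) (H \<circ> r) (g s) sequentially"
      by (rule uniform_limit_on_subset[OF ul[of "cball 0 (1/2)"]]) auto
    show "\<forall>\<^sub>F n in sequentially. (H \<circ> r) n holomorphic_on ball 0 (1/2)"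
      by (intro always_eventually allI) (auto intro: holomorphic_on_subset[OF holH])
  qed auto
  moreover have "deriv (H n) 0 = 1 / c 0 s" for n
  proof -
    have "deriv (H n) 0 = c s (real (n + N)) / c 0 (real (n + N))"
      unfolding H_def[abs_def] c_def[of s]
      using holomorphic_on_imp_differentiable_at[OF hol[OF s N], of 0] by (intro deriv_cdivide_right) auto
    then show ?thesis using c_mult[OF _ s N] c_nonzero[OF s N] by simp
  qed
  ultimately show dg: "deriv (g s) 0 = 1 / c 0 s"
    by (simp add: o_def LIMSEQ_const_iff)
  show nc: "\<not> g s constant_on ball 0 1"
  proof
    assume "g s constant_on ball 0 1"
    then obtain a where "\<And>z. z \<in> ball 0 1 \<Longrightarrow> g s z = a" unfolding constant_on_def by blast
    then have "deriv (g s) 0 = deriv (\<lambda>z. a) 0"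
      by (intro deriv_cong_ev eventually_nhds_in_open[THEN eventually_mono, of "ball 0 1"]) auto
    then show False using dg c_nonzero[of 0 s] s by simp
  qed
  show "inj_on (g s) (ball 0 1)"
  proof (rule Hurwitz_injective[OF _ _ _ holg ul nc])
    fix n
    have "inj_on (\<psi> s (real (r n + N))) (ball 0 1)" using inj[OF s N] .
    then show "inj_on ((H \<circ> r) n) (ball 0 1)" using nz unfolding inj_on_def H_def o_def by simp
  qed (use holH in auto)
qed

lemma g_zero: "0 \<le> s \<Longrightarrow> g s 0 = 0"
proof -
  assume s: "0 \<le> s"
  have "(\<lambda>n. \<psi> s (real n) 0 / c 0 (real n)) \<longlonglongrightarrow> 0"
    by (rule tendsto_eventually, rule eventually_mono[OF eventually_ge_at_top[of "nat \<lceil>s\<rceil>"]])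
       (use s zero in \<open>auto simp: nat_le_iff ceiling_le_iff\<close>)
  then show ?thesis using g_LIMSEQ[of s 0] s LIMSEQ_unique by auto
qed

section \<open>The union of the ranges\<close>

text \<open>Upper inclusion: |\<psi>| < 1 survives in the limit as |g t| <= 1/\<beta>, and openness
  makes it strict. Lower inclusion: \<beta> g t is a self-map fixing 0 with derivative of modulus
  \<beta> / |c 0 t|, which tends to 1, so it nearly fills the disk.\<close>

lemma g_range_disk:
  assumes \<beta>: "((\<lambda>t. cmod (c 0 t)) \<longlongrightarrow> \<beta>) at_top" "0 < \<beta>"
  shows "(\<Union>t\<in>{0..}. g t ` ball 0 1) = ball 0 (1 / \<beta>)"
proof
  have le: "cmod (g t z) \<le> 1 / \<beta>" if t: "0 \<le> t" and z: "cmod z < 1" for t z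
  proof (rule LIMSEQ_le)
    show "(\<lambda>n. cmod (\<psi> t (real n) z / c 0 (real n))) \<longlonglongrightarrow> cmod (g t z)"
      using that by (intro tendsto_norm g_LIMSEQ) auto
    have "(\<lambda>n. cmod (c 0 (real n))) \<longlonglongrightarrow> \<beta>" using filterlim_compose[OF \<beta>(1) filterlim_real_sequentially] .
    then show "(\<lambda>n. 1 / cmod (c 0 (real n))) \<longlonglongrightarrow> 1 / \<beta>" using \<beta> by (intro tendsto_intros) auto
    show "\<exists>N. \<forall>n\<ge>N. cmod (\<psi> t (real n) z / c 0 (real n)) \<le> 1 / cmod (c 0 (real n))"
    proof (intro exI allI impI)
      fix n assume "n \<ge> nat \<lceil>t\<rceil>"
      then have n: "t \<le> real n" by linarith
      show "cmod (\<psi> t (real n) z / c 0 (real n)) \<le> 1 / cmod (c 0 (real n))"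
        unfolding norm_divide using norm_less[OF t n z] by (intro divide_right_mono) auto
    qed
  qed
  have lt: "g t ` ball 0 1 \<subseteq> ball 0 (1 / \<beta>)" if t: "0 \<le> t" for t
  proof -
    have "open (g t ` ball 0 1)"
      by (rule open_mapping_thm[OF g_holomorphic[OF t] _ _ _ order_refl g_nonconst[OF t]]) auto
    then have "g t ` ball 0 1 \<subseteq> interior (cball 0 (1 / \<beta>))" using le[OF t] by (intro interior_maximal) auto
    then show ?thesis by simp
  qed
  then show "(\<Union>t\<in>{0..}. g t ` ball 0 1) \<subseteq> ball 0 (1 / \<beta>)" by auto
  show "ball 0 (1 / \<beta>) \<subseteq> (\<Union>t\<in>{0..}. g t ` ball 0 1)"
  proof
    fix w :: complex assume "w \<in> ball 0 (1 / \<beta>)"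
    then have w: "\<beta> * cmod w < 1" using \<beta> by (simp add: field_simps)
    then obtain \<rho> where \<rho>: "max 0 (\<beta> * cmod w) < \<rho>" "\<rho> < 1" using dense[of "max 0 (\<beta> * cmod w)" 1] by auto
    have \<rho>0: "0 < \<rho>" "\<beta> * cmod w < \<rho>" using \<rho> by auto
    have \<rho>2: "0 < 1 - \<rho>\<^sup>2" using \<rho> \<rho>0 by (simp add: abs_square_less_1)
    \<comment> \<open>The lower bound for |\<beta> g t| on |z| = \<rho> given by the second estimate
      of \<open>Schwarz_Pick_origin\<close>. It tends to \<rho>, which was chosen above
      \<beta>|w|.\<close>
    define m where "m t = \<rho> * (1 - 4 * (1 - \<beta> / cmod (c 0 t)) / (1 - \<rho>\<^sup>2))" for t
    have "(m \<longlongrightarrow> \<rho> * (1 - 4 * (1 - \<beta> / \<beta>) / (1 - \<rho>\<^sup>2))) at_top"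
      unfolding m_def using \<beta> \<rho>2 by (intro tendsto_intros) auto
    then have "eventually (\<lambda>t. \<beta> * cmod w < m t) at_top" using \<beta> \<rho>0 by (intro order_tendstoD) auto
    then have "eventually (\<lambda>t. \<beta> * cmod w < m t \<and> 0 \<le> t) at_top"
      using eventually_ge_at_top[of 0] by (rule eventually_conj)
    then obtain t where t: "\<beta> * cmod w < m t" "0 \<le> t" using eventually_happens by fastforce
    define G where "G z = \<beta> * g t z" for z
    have holG: "G holomorphic_on ball 0 1" unfolding G_def[abs_def] by (intro holomorphic_intros g_holomorphic t)
    have Gim: "G ` ball 0 1 \<subseteq> ball 0 1"
      using lt[OF t(2)] \<beta> by (auto simp: G_def norm_mult image_subset_iff field_simps)
    have G0: "G 0 = 0" by (simp add: G_def g_zero t)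
    have dG: "deriv G 0 = \<beta> / c 0 t" unfolding G_def[abs_def]
      using holomorphic_on_imp_differentiable_at[OF g_holomorphic[OF t(2)], of 0] g_deriv[OF t(2)] by simp
    obtain p where p: "p holomorphic_on ball 0 1" "p ` ball 0 1 \<subseteq> cball 0 1" "p 0 = deriv G 0"
      "\<And>z. cmod z < 1 \<Longrightarrow> G z = z * p z"
      using Schwarz_quotient[OF holG Gim G0] by blast
    have "ball 0 (m t) \<subseteq> G ` ball 0 1"
    proof (rule covers_ball_if_large_on_sphere[OF holG G0 \<rho>0(1) \<rho>(2)])
      have "0 \<le> \<beta> * cmod w" using \<beta> by simp
      then show "0 < m t" using t by linarith
      fix z assume z: "cmod z = \<rho>"
      have "(1 - cmod (p z)) * (1 - \<rho>\<^sup>2) \<le> 4 * (1 - \<beta> / cmod (c 0 t))"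
        using Schwarz_Pick_origin(2)[OF p(1,2), of z] z \<rho> p(3) dG \<beta> by (simp add: norm_divide)
      then have "1 - cmod (p z) \<le> 4 * (1 - \<beta> / cmod (c 0 t)) / (1 - \<rho>\<^sup>2)"
        by (simp only: pos_le_divide_eq[OF \<rho>2])
      then have "m t \<le> \<rho> * cmod (p z)" unfolding m_def using \<rho>0 by (intro mult_left_mono) auto
      then show "m t \<le> cmod (G z)" using p(4)[of z] z \<rho> by (simp add: norm_mult)
    qed
    moreover have "\<beta> * w \<in> ball 0 (m t)" using t \<beta> by (simp add: norm_mult)
    ultimately obtain z where z: "z \<in> ball 0 1" "\<beta> * w = G z" by blast
    then have "w = g t z" using \<beta> by (simp add: G_def)
    then show "w \<in> (\<Union>t\<in>{0..}. g t ` ball 0 1)" using z(1) t by (intro UN_I[of t]) auto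
  qed
qed

text \<open>On the half disk |g t| is at most a constant over |c 0 t|. Rescaling by c 0 t gives
  self-maps with derivative \<open>b\<close> at 0 independent of t, all covering one fixed disk;
  scaled back, the radius grows like 1/|c 0 t|.\<close>

lemma g_range_plane:
  assumes \<beta>: "((\<lambda>t. cmod (c 0 t)) \<longlongrightarrow> 0) at_top"
  shows "(\<Union>t\<in>{0..}. g t ` ball 0 1) = UNIV"
proof -
  \<comment> \<open>The bound of \<open>g_bound\<close> for r = 1/2; the added 1 makes the rescaled
    map land strictly inside the disk.\<close>
  define M where "M = exp (16 / (1 - 1/2 :: real)\<^sup>2) + 1"
  define b where "b = 1 / (2 * M)"
  have M: "1 < M" by (simp add: M_def)
  have b: "0 < b" "b < 1/2" using M by (auto simp: b_def)
  have "w \<in> (\<Union>t\<in>{0..}. g t ` ball 0 1)" for w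
  proof -
    define m where "m = b\<^sup>2 / 16"
    have m: "0 < m" using b by (simp add: m_def)
    have "((\<lambda>t. cmod (c 0 t) * cmod w / M) \<longlongrightarrow> 0 * cmod w / M) at_top"
      using M by (intro tendsto_intros \<beta>) auto
    then have "eventually (\<lambda>t. cmod (c 0 t) * cmod w / M < m) at_top" using m by (intro order_tendstoD) auto
    then have "eventually (\<lambda>t. cmod (c 0 t) * cmod w / M < m \<and> 0 \<le> t) at_top"
      using eventually_ge_at_top[of 0] by (rule eventually_conj)
    then obtain t where t: "cmod (c 0 t) * cmod w / M < m" "0 \<le> t" using eventually_happens by fastforce
    have ct: "c 0 t \<noteq> 0" using c_nonzero t by simp
    define G where "G z = c 0 t / M * g t (z / 2)" for z
    have half: "(\<lambda>z::complex. z / 2) ` ball 0 1 \<subseteq> ball 0 1" by (auto simp: norm_divide)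
    have "(g t \<circ> (\<lambda>z. z / 2)) holomorphic_on ball 0 1"
      by (rule holomorphic_on_compose_gen[OF _ g_holomorphic[OF t(2)] half]) (intro holomorphic_intros; simp)
    then have holG: "G holomorphic_on ball 0 1" unfolding G_def[abs_def] o_def
      by (intro holomorphic_intros) (use M in auto)
    have Gim: "G ` ball 0 1 \<subseteq> ball 0 1"
    proof (clarsimp simp: G_def norm_mult norm_divide)
      fix z :: complex assume "cmod z < 1"
      then have "cmod (g t (z / 2)) \<le> (M - 1) / cmod (c 0 t)"
        using g_bound[OF t(2), of "z/2" "1/2"] by (simp add: M_def norm_divide)
      then have "cmod (c 0 t) * cmod (g t (z / 2)) \<le> M - 1" using ct by (simp add: pos_le_divide_eq mult.commute)
      then show "cmod (c 0 t) * cmod (g t (z / 2)) / \<bar>M\<bar> < 1" using M by (simp add: divide_simps)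
    qed
    have G0: "G 0 = 0" using g_zero t by (simp add: G_def)
    have dG: "deriv G 0 = b"
    proof -
      have "(g t has_field_derivative 1 / c 0 t) (at (0 / 2))"
        using holomorphic_derivI[OF g_holomorphic[OF t(2)], of 0] g_deriv[OF t(2)] by simp
      then have "(G has_field_derivative (c 0 t / M * (1 / c 0 t * (1 / 2)))) (at 0)"
        unfolding G_def[abs_def]
        by (intro DERIV_cmult DERIV_chain'[where g = "g t" and f = "\<lambda>z. z / 2"]) (auto intro!: derivative_eq_intros)
      then show ?thesis using ct by (simp add: DERIV_imp_deriv b_def)
    qed
    obtain p where p: "p holomorphic_on ball 0 1" "p ` ball 0 1 \<subseteq> cball 0 1" "p 0 = deriv G 0"
      "\<And>z. cmod z < 1 \<Longrightarrow> G z = z * p z"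
      using Schwarz_quotient[OF holG Gim G0] by blast
    have "ball 0 m \<subseteq> G ` ball 0 1"
    \<comment> \<open>On |z| = b/8 the quotient p moves by at most b/2 from its value b at 0, so |G|
      >= (b/8)(b/2) = m.\<close>
    proof (rule covers_ball_if_large_on_sphere[OF holG G0, of "b/8"])
      fix z assume z: "cmod z = b / 8"
      have z1: "cmod z < 1" using z b by simp
      have p0: "cmod (p 0) = b" using p(3) dG b by simp
      have "cmod (p z - p 0) * (1/2) \<le> cmod (p z - p 0) * (1 - cmod z)"
        using z b by (intro mult_left_mono) auto
      also have "\<dots> \<le> 2 * cmod z * (1 - cmod (p 0))" by (rule Schwarz_Pick_origin(3)[OF p(1,2) z1])
      also have "\<dots> \<le> 2 * cmod z * 1" using p0 b by (intro mult_left_mono) auto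
      finally have "cmod (p z - p 0) \<le> b / 2" using z by simp
      then have "b / 2 \<le> cmod (p z)" using p0 norm_triangle_ineq2[of "p 0" "p z"] by (simp add: norm_minus_commute)
      then have "b / 8 * (b / 2) \<le> b / 8 * cmod (p z)" using b by (intro mult_left_mono) auto
      then have "m \<le> cmod z * cmod (p z)" unfolding z m_def power2_eq_square by simp
      then show "m \<le> cmod (G z)" using p(4)[OF z1] by (simp add: norm_mult)
    qed (use b m in auto)
    moreover have "c 0 t * w / M \<in> ball 0 m" using t M by (simp add: norm_mult norm_divide)
    ultimately obtain z where z: "z \<in> ball 0 1" "c 0 t * w / M = G z" by blast
    then have "w = g t (z / 2)" using M ct by (simp add: G_def)
    moreover have "z / 2 \<in> ball 0 1" using z half by blast
    ultimately have "w \<in> g t ` ball 0 1" by blast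
    then show ?thesis using t by (intro UN_I[of t]) auto
  qed
  then show ?thesis by blast
qed

end

subsection \<open>Kernels\<close>

text \<open>L^d is contained in L^1 on a bounded interval: for finite d, k <= 1 + k^d. Without
  integrability the Bochner integral defaults to 0 and could not be split or added.\<close>

lemma Ld_nonneg_imp_set_integrable:
  assumes d: "1 \<le> d" and k: "Ld_nonneg d T k"
  shows "set_integrable lebesgue {0..T} k"
proof -
  have meas: "(\<lambda>x. indicator {0..T} x *\<^sub>R k x) \<in> borel_measurable lebesgue" and k0: "\<And>x. 0 \<le> k x"
    using k by (auto simp: Ld_nonneg_def set_borel_measurable_def)
  have const: "integrable lebesgue (\<lambda>x. indicator {0..T} x *\<^sub>R C)" for C :: real
    using lmeasurable_cbox[of 0 T] by (simp add: fmeasurable_def)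
  show ?thesis
  proof (cases "d = \<infinity>")
    case True
    then obtain C where C: "AE x in lebesgue. x \<in> {0..T} \<longrightarrow> k x \<le> C" using k by (auto simp: Ld_nonneg_def)
    show ?thesis unfolding set_integrable_def
      by (rule Bochner_Integration.integrable_bound[OF const[of C] meas])
         (use C in eventually_elim, auto simp: indicator_def k0)
  next
    case False
    define p where "p = real_of_ereal d"
    have p: "1 \<le> p" using d False by (cases d) (auto simp: p_def)
    have "integrable lebesgue (\<lambda>x. indicator {0..T} x *\<^sub>R (k x powr p))"
      using k False by (auto simp: Ld_nonneg_def set_integrable_def p_def)
    then have "integrable lebesgue (\<lambda>x. indicator {0..T} x *\<^sub>R 1 + indicator {0..T} x *\<^sub>R (k x powr p))"
      by (intro Bochner_Integration.integrable_add const)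
    then show ?thesis unfolding set_integrable_def
    proof (rule Bochner_Integration.integrable_bound[OF _ meas], intro AE_I2)
      fix x
      have "k x \<le> 1 + k x powr p"
      proof (cases "k x \<le> 1")
        case False
        then have "k x powr 1 \<le> k x powr p" using p by (intro powr_mono) auto
        then show ?thesis using False by simp
      qed (simp add: add_increasing2)
      then show "norm (indicator {0..T} x *\<^sub>R k x) \<le> norm (indicator {0..T} x *\<^sub>R 1 + indicator {0..T} x *\<^sub>R (k x powr p))"
        using k0[of x] by (simp add: indicator_def)
    qed
  qed
qed

lemma Ld_nonneg_scaled_add:
  assumes d: "1 \<le> d" and k: "Ld_nonneg d T k" and l: "Ld_nonneg d T l" and L: "0 \<le> L"
  shows "Ld_nonneg d T (\<lambda>x. L * (k x + l x))"
proof -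
  have k0: "\<And>x. 0 \<le> k x" and l0: "\<And>x. 0 \<le> l x"
    and mk: "(\<lambda>x. indicator {0..T} x *\<^sub>R k x) \<in> borel_measurable lebesgue"
    and ml: "(\<lambda>x. indicator {0..T} x *\<^sub>R l x) \<in> borel_measurable lebesgue"
    using k l by (auto simp: Ld_nonneg_def set_borel_measurable_def)
  have meas: "(\<lambda>x. indicator {0..T} x *\<^sub>R (L * (k x + l x))) \<in> borel_measurable lebesgue"
  proof -
    have "(\<lambda>x. L * (indicator {0..T} x *\<^sub>R k x + indicator {0..T} x *\<^sub>R l x)) \<in> borel_measurable lebesgue"
      by (intro borel_measurable_times borel_measurable_add borel_measurable_const mk ml)
    then show ?thesis by (simp add: algebra_simps)
  qed
  show ?thesis
  proof (cases "d = \<infinity>")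
    case True
    obtain C where C: "AE x in lebesgue. x \<in> {0..T} \<longrightarrow> k x \<le> C" using k True by (auto simp: Ld_nonneg_def)
    obtain D where D: "AE x in lebesgue. x \<in> {0..T} \<longrightarrow> l x \<le> D" using l True by (auto simp: Ld_nonneg_def)
    have "AE x in lebesgue. x \<in> {0..T} \<longrightarrow> L * (k x + l x) \<le> L * (C + D)"
      using C D by eventually_elim (auto intro!: mult_left_mono add_mono L)
    then show ?thesis using True k0 l0 L meas by (auto simp: Ld_nonneg_def set_borel_measurable_def)
  next
    case False
    define p where "p = real_of_ereal d"
    have p: "1 \<le> p" using d False by (cases d) (auto simp: p_def)
    have ik: "integrable lebesgue (\<lambda>x. indicator {0..T} x *\<^sub>R (k x powr p))"
      and il: "integrable lebesgue (\<lambda>x. indicator {0..T} x *\<^sub>R (l x powr p))"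
      using k l False by (auto simp: Ld_nonneg_def set_integrable_def p_def)
    have "(\<lambda>x. (indicator {0..T} x *\<^sub>R (L * (k x + l x))) powr p) \<in> borel_measurable lebesgue"
      using meas by measurable
    moreover have "(indicator {0..T} x *\<^sub>R (L * (k x + l x))) powr p = indicator {0..T} x *\<^sub>R ((L * (k x + l x)) powr p)" for x
      by (simp add: indicator_def)
    ultimately have meas': "(\<lambda>x. indicator {0..T} x *\<^sub>R ((L * (k x + l x)) powr p)) \<in> borel_measurable lebesgue" by simp
    have "integrable lebesgue (\<lambda>x. (L * 2) powr p * (indicator {0..T} x *\<^sub>R (k x powr p) + indicator {0..T} x *\<^sub>R (l x powr p)))"
      by (intro integrable_mult_right Bochner_Integration.integrable_add ik il)
    then have "integrable lebesgue (\<lambda>x. indicator {0..T} x *\<^sub>R ((L * (k x + l x)) powr p))"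
    proof (rule Bochner_Integration.integrable_bound[OF _ meas'], intro AE_I2)
      fix x
      \<comment> \<open>k + l <= 2 max(k, l), and the power of the maximum is at most the sum of the
        powers.\<close>
      define m where "m = max (k x) (l x)"
      have "(L * (k x + l x)) powr p \<le> (L * 2 * m) powr p"
        using p L k0[of x] l0[of x] by (intro powr_mono2) (auto simp: m_def mult.assoc intro!: mult_left_mono)
      also have "\<dots> = (L * 2) powr p * m powr p" using L k0[of x] by (intro powr_mult)
      also have "\<dots> \<le> (L * 2) powr p * (k x powr p + l x powr p)"
        by (intro mult_left_mono) (auto simp: m_def max_def)
      finally show "norm (indicator {0..T} x *\<^sub>R ((L * (k x + l x)) powr p))
        \<le> norm ((L * 2) powr p * (indicator {0..T} x *\<^sub>R (k x powr p) + indicator {0..T} x *\<^sub>R (l x powr p)))"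
        by (simp add: indicator_def abs_mult)
    qed
    then show ?thesis using False k0 l0 L meas
      by (auto simp: Ld_nonneg_def set_borel_measurable_def set_integrable_def p_def)
  qed
qed

lemma Ld_nonneg_subinterval_integrable:
  assumes "1 \<le> d" "Ld_nonneg d T k" "0 \<le> s" "t \<le> T"
  shows "set_integrable lebesgue {s..t} k"
  by (rule set_integrable_subset[OF Ld_nonneg_imp_set_integrable[OF assms(1,2)]]) (use assms in auto)

text \<open>Absolute continuity of the integral, read off from uniform continuity of the indefinite
  integral on the compact interval.\<close>

lemma Ld_nonneg_small_integral:
  assumes d: "1 \<le> d" and k: "Ld_nonneg d T k" and e: "0 < e"
  obtains \<delta> where "0 < \<delta>"
    "\<And>s t. \<lbrakk>0 \<le> s; s \<le> t; t \<le> T; t - s < \<delta>\<rbrakk> \<Longrightarrow> set_lebesgue_integral lebesgue {s..t} k < e"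
proof -
  have int: "k integrable_on {0..T}"
    using set_lebesgue_integral_eq_integral(1)[OF Ld_nonneg_imp_set_integrable[OF d k]] .
  have "uniformly_continuous_on {0..T} (\<lambda>x. integral {0..x} k)"
    by (intro compact_uniformly_continuous indefinite_integral_continuous_1 int) simp
  then obtain \<delta> where \<delta>: "0 < \<delta>" "\<And>x y. \<lbrakk>x \<in> {0..T}; y \<in> {0..T}; dist y x < \<delta>\<rbrakk>
      \<Longrightarrow> dist (integral {0..y} k) (integral {0..x} k) < e"
    unfolding uniformly_continuous_on_def using e by metis
  show ?thesis
  proof (rule that[OF \<delta>(1)])
    fix s t assume st: "0 \<le> s" "s \<le> t" "t \<le> T" "t - s < \<delta>"
    have "set_lebesgue_integral lebesgue {s..t} k = integral {s..t} k"
      by (rule set_lebesgue_integral_eq_integral(2)[OF Ld_nonneg_subinterval_integrable[OF d k]]) (use st in auto)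
    also have "k integrable_on {0..t}" using int st by (auto intro: integrable_subinterval_real)
    then have "integral {s..t} k = integral {0..t} k - integral {0..s} k"
      using Henstock_Kurzweil_Integration.integral_combine[of 0 s t k] st by simp
    also have "\<dots> < e" using \<delta>(2)[of s t] st by (auto simp: dist_real_def)
    finally show "set_lebesgue_integral lebesgue {s..t} k < e" .
  qed
qed

subsection \<open>General evolution families\<close>

lemma Moebius_inverse:
  assumes "cmod a < 1" "cmod z < 1"
  shows "Moebius_function 0 (-a) (Moebius_function 0 a z) = z"
    and "Moebius_function 0 a (Moebius_function 0 (-a) z) = z"
  using Moebius_function_compose[of "-a" a z] Moebius_function_compose[of a "-a" z] assms by auto

lemma Moebius_image_disk:
  assumes "cmod a < 1"
  shows "Moebius_function 0 a ` ball 0 1 = ball 0 1"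
proof
  show "Moebius_function 0 a ` ball 0 1 \<subseteq> ball 0 1" using Moebius_function_norm_lt_1 assms by auto
  show "ball 0 1 \<subseteq> Moebius_function 0 a ` ball 0 1"
  proof
    fix z :: complex assume "z \<in> ball 0 1"
    then show "z \<in> Moebius_function 0 a ` ball 0 1"
      using Moebius_inverse(2)[of a z] Moebius_function_norm_lt_1[of "-a" z 0] assms
      by (intro image_eqI[of _ _ "Moebius_function 0 (-a) z"]) auto
  qed
qed

lemma Moebius_inj: "cmod a < 1 \<Longrightarrow> inj_on (Moebius_function 0 a) (ball 0 1)"
  by (rule inj_on_inverseI[of _ "Moebius_function 0 (-a)"]) (simp add: Moebius_inverse)

lemma Moebius_0 [simp]: "Moebius_function 0 0 z = z"
  by (simp add: Moebius_function_simple)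

lemma deriv_Moebius_centre:
  assumes "cmod a < 1"
  shows "deriv (Moebius_function 0 a) a = 1 / (1 - complex_of_real ((cmod a)\<^sup>2))"
proof -
  have nz: "1 - cnj a * a \<noteq> 0" using one_minus_cnj_mult_nonzero[of a a] assms by simp
  have "(Moebius_function 0 a has_field_derivative
      ((1 - 0) * (1 - cnj a * a) - (a - a) * (0 - cnj a * 1)) / ((1 - cnj a * a) * (1 - cnj a * a))) (at a)"
    unfolding Moebius_function_simple[abs_def]
    by (rule DERIV_divide) (use nz in \<open>auto intro!: derivative_eq_intros\<close>)
  then have "deriv (Moebius_function 0 a) a = 1 / (1 - cnj a * a)"
    using nz by (simp add: DERIV_imp_deriv)
  then show ?thesis unfolding complex_norm_square by (simp add: mult.commute)
qed

locale disk_evolution =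
  fixes d :: ereal and \<phi> :: "real \<Rightarrow> real \<Rightarrow> complex \<Rightarrow> complex"
  assumes d: "1 \<le> d" and ev: "evolution_family d \<phi>"
begin

lemma hol: "\<lbrakk>0 \<le> s; s \<le> t\<rbrakk> \<Longrightarrow> \<phi> s t holomorphic_on ball 0 1"
  and into: "\<lbrakk>0 \<le> s; s \<le> t\<rbrakk> \<Longrightarrow> \<phi> s t ` ball 0 1 \<subseteq> ball 0 1"
  and refl: "\<lbrakk>0 \<le> s; cmod z < 1\<rbrakk> \<Longrightarrow> \<phi> s s z = z"
  and comp: "\<lbrakk>0 \<le> s; s \<le> u; u \<le> t; cmod z < 1\<rbrakk> \<Longrightarrow> \<phi> s t z = \<phi> u t (\<phi> s u z)"
  using ev unfolding evolution_family_def by simp_all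

lemma norm_less: "\<lbrakk>0 \<le> s; s \<le> t; cmod z < 1\<rbrakk> \<Longrightarrow> cmod (\<phi> s t z) < 1"
  using into by (force simp: image_subset_iff)

lemma kernel:
  assumes "cmod z < 1" "0 < T"
  obtains k where "Ld_nonneg d T k"
    "\<And>s u t. \<lbrakk>0 \<le> s; s \<le> u; u \<le> t; t \<le> T\<rbrakk> \<Longrightarrow> cmod (\<phi> s u z - \<phi> s t z) \<le> set_lebesgue_integral lebesgue {u..t} k"
proof -
  have "\<forall>z\<in>unit_disk. \<forall>T>0. \<exists>k. Ld_nonneg d T k \<and>
        (\<forall>s u t. 0 \<le> s \<and> s \<le> u \<and> u \<le> t \<and> t \<le> T \<longrightarrow>
           cmod (\<phi> s u z - \<phi> s t z) \<le> set_lebesgue_integral lebesgue {u..t} k)"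
    using ev unfolding evolution_family_def by blast
  moreover have "z \<in> unit_disk" using assms by simp
  ultimately have "\<exists>k. Ld_nonneg d T k \<and>
        (\<forall>s u t. 0 \<le> s \<and> s \<le> u \<and> u \<le> t \<and> t \<le> T \<longrightarrow>
           cmod (\<phi> s u z - \<phi> s t z) \<le> set_lebesgue_integral lebesgue {u..t} k)" using assms(2) by blast
  then show ?thesis using that by blast
qed

lemma equicontinuous:
  assumes "cmod z < 1" "0 < T" "0 < e"
  obtains \<delta> where "0 < \<delta>"
    "\<And>s u t. \<lbrakk>0 \<le> s; s \<le> u; u \<le> t; t \<le> T; t - u < \<delta>\<rbrakk> \<Longrightarrow> cmod (\<phi> s u z - \<phi> s t z) < e"
proof -
  obtain k where k: "Ld_nonneg d T k"
    "\<And>s u t. \<lbrakk>0 \<le> s; s \<le> u; u \<le> t; t \<le> T\<rbrakk> \<Longrightarrow> cmod (\<phi> s u z - \<phi> s t z) \<le> set_lebesgue_integral lebesgue {u..t} k"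
    using kernel[OF assms(1,2)] by blast
  obtain \<delta> where \<delta>: "0 < \<delta>"
    "\<And>s t. \<lbrakk>0 \<le> s; s \<le> t; t \<le> T; t - s < \<delta>\<rbrakk> \<Longrightarrow> set_lebesgue_integral lebesgue {s..t} k < e"
    using Ld_nonneg_small_integral[OF d k(1) assms(3)] by blast
  show ?thesis
  proof (rule that[OF \<delta>(1)])
    fix s u t assume "0 \<le> s" "s \<le> u" "u \<le> t" "t \<le> T" "t - u < \<delta>"
    then show "cmod (\<phi> s u z - \<phi> s t z) < e"
      using k(2)[of s u t] \<delta>(2)[of u t] by simp
  qed
qed

lemma continuous_in_time:
  assumes z: "cmod z < 1"
  shows "continuous_on {0..} (\<lambda>t. \<phi> 0 t z)"
  unfolding continuous_on_iff
proof (intro ballI allI impI)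
  fix t e :: real assume t: "t \<in> {0..}" and e: "0 < e"
  obtain \<delta> where \<delta>: "0 < \<delta>"
    "\<And>s u v. \<lbrakk>0 \<le> s; s \<le> u; u \<le> v; v \<le> t + 1; v - u < \<delta>\<rbrakk> \<Longrightarrow> cmod (\<phi> s u z - \<phi> s v z) < e"
    using equicontinuous[OF z, of "t + 1" e] t e by auto
  show "\<exists>\<delta>>0. \<forall>x\<in>{0..}. dist x t < \<delta> \<longrightarrow> dist (\<phi> 0 x z) (\<phi> 0 t z) < e"
  proof (intro exI conjI ballI impI)
    show "0 < min \<delta> 1" using \<delta> by simp
    fix x assume x: "x \<in> {0..}" "dist x t < min \<delta> 1"
    show "dist (\<phi> 0 x z) (\<phi> 0 t z) < e"
    proof (cases "x \<le> t")
      case True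
      then show ?thesis using \<delta>(2)[of 0 x t] x by (simp add: dist_norm)
    next
      case False
      then show ?thesis using \<delta>(2)[of 0 t x] x t by (simp add: dist_norm norm_minus_commute)
    qed
  qed
qed

definition a :: "real \<Rightarrow> complex" where "a t = \<phi> 0 t 0"

text \<open>The automorphism with parameter \<open>- a s\<close> inverts the one with parameter
  \<open>a s\<close>. Intermediate automorphisms cancel, so the composition law survives, and
  \<open>\<phi> s t\<close> carries \<open>a s\<close> to \<open>a t\<close>, so 0 is fixed.\<close>

definition \<psi> :: "real \<Rightarrow> real \<Rightarrow> complex \<Rightarrow> complex" where
  "\<psi> s t = Moebius_function 0 (a t) \<circ> \<phi> s t \<circ> Moebius_function 0 (- a s)"

lemma a_less: "0 \<le> t \<Longrightarrow> cmod (a t) < 1"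
  by (simp add: a_def norm_less)

lemma a_transport: "\<lbrakk>0 \<le> s; s \<le> t\<rbrakk> \<Longrightarrow> \<phi> s t (a s) = a t"
  using comp[of 0 s t 0] by (simp add: a_def)

lemma Moebius_less: "\<lbrakk>0 \<le> t; cmod z < 1\<rbrakk> \<Longrightarrow> cmod (Moebius_function 0 (a t) z) < 1"
  "\<lbrakk>0 \<le> t; cmod z < 1\<rbrakk> \<Longrightarrow> cmod (Moebius_function 0 (- a t) z) < 1"
  using Moebius_function_norm_lt_1 a_less by auto

lemma \<psi>_hol: "\<lbrakk>0 \<le> s; s \<le> t\<rbrakk> \<Longrightarrow> \<psi> s t holomorphic_on ball 0 1"
  unfolding \<psi>_def
  by (intro holomorphic_on_compose_gen[of _ _ _ "ball 0 1"] Moebius_function_holomorphic hol)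
     (auto simp: a_less Moebius_less norm_less)

lemma \<psi>_less: "\<lbrakk>0 \<le> s; s \<le> t; cmod z < 1\<rbrakk> \<Longrightarrow> cmod (\<psi> s t z) < 1"
  by (simp add: \<psi>_def a_less Moebius_less norm_less)

lemma \<psi>_zero: "\<lbrakk>0 \<le> s; s \<le> t\<rbrakk> \<Longrightarrow> \<psi> s t 0 = 0"
  by (simp add: \<psi>_def Moebius_function_of_zero a_transport Moebius_function_eq_zero)

lemma \<psi>_norm_le: "\<lbrakk>0 \<le> s; s \<le> t; cmod z < 1\<rbrakk> \<Longrightarrow> cmod (\<psi> s t z) \<le> cmod z"
  by (rule Schwarz_Lemma(1)[OF \<psi>_hol \<psi>_zero \<psi>_less])

lemma \<psi>_conj:
  assumes "0 \<le> s" "s \<le> t" "cmod z < 1"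
  shows "\<psi> s t (Moebius_function 0 (a s) z) = Moebius_function 0 (a t) (\<phi> s t z)"
  using assms by (simp add: \<psi>_def Moebius_inverse a_less)

section \<open>Compact orbits and univalence of the evolution family\<close>

text \<open>After conjugation the modulus does not increase. The centres \<open>a t\<close> stay in
  a compact subset of the disk for t <= T by continuity, so both changes of coordinates are
  controlled uniformly.\<close>

lemma uniform_bound:
  assumes T: "0 < T" and r: "r < 1"
  obtains R where "0 < R" "R < 1" "\<And>s t z. \<lbrakk>0 \<le> s; s \<le> t; t \<le> T; cmod z \<le> r\<rbrakk> \<Longrightarrow> cmod (\<phi> s t z) \<le> R"
proof -
  have "continuous_on {0..T} (\<lambda>t. cmod (a t))"
    unfolding a_def
    by (intro continuous_on_norm continuous_on_subset[OF continuous_in_time]) auto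
  then obtain t0 where t0: "t0 \<in> {0..T}" "\<And>t. t \<in> {0..T} \<Longrightarrow> cmod (a t) \<le> cmod (a t0)"
    using continuous_attains_sup[of "{0..T}" "\<lambda>t. cmod (a t)"] T by auto
  define A where "A = cmod (a t0)"
  have A: "A < 1" "\<And>t. t \<in> {0..T} \<Longrightarrow> cmod (a t) \<le> A" using t0 a_less by (auto simp: A_def)
  obtain B where B: "B < 1" "\<And>a z. cmod a \<le> A \<Longrightarrow> cmod z \<le> r \<Longrightarrow> cmod (Moebius_function 0 a z) \<le> B"
    using Moebius_uniform_bound[OF A(1) r] by metis
  obtain R where R: "R < 1" "0 < R" "\<And>a z. cmod a \<le> A \<Longrightarrow> cmod z \<le> B \<Longrightarrow> cmod (Moebius_function 0 a z) \<le> R"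
    using Moebius_uniform_bound[OF A(1) B(1)] by metis
  show ?thesis
  proof (rule that[OF R(2,1)])
    fix s t z assume st: "0 \<le> s" "s \<le> t" "t \<le> T" and z: "cmod z \<le> r"
    have z1: "cmod z < 1" using z r by simp
    let ?w = "Moebius_function 0 (a s) z"
    have w: "cmod ?w \<le> B" "cmod ?w < 1" using B(2) A(2) z st Moebius_less z1 by auto
    have "cmod (\<psi> s t ?w) \<le> B" using \<psi>_norm_le[of s t ?w] w st by simp
    then have "cmod (Moebius_function 0 (- a t) (\<psi> s t ?w)) \<le> R" using A(2) st by (intro R(3)) auto
    then show "cmod (\<phi> s t z) \<le> R"
      using \<psi>_conj[of s t z] Moebius_inverse(1)[OF a_less norm_less[OF _ _ z1]] st z1 by simp
  qed
qed

text \<open>For short times \<phi> - id is small on a larger disk, so by Cauchy it is 1/2-Lipschitz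
  on \<open>cball 0 R\<close>; equal images would give |z - w| <= |z - w|/2.\<close>

lemma locally_injective:
  assumes T: "0 < T" and R: "0 < R" "R < 1"
  obtains \<delta> where "0 < \<delta>"
    "\<And>s t. \<lbrakk>0 \<le> s; s \<le> t; t \<le> T; t - s < \<delta>\<rbrakk> \<Longrightarrow> inj_on (\<phi> s t) (cball 0 R)"
proof -
  define R' where "R' = (1 + R) / 2"
  have R': "R < R'" "R' < 1" using R by (auto simp: R'_def)
  obtain C where C: "0 < C"
    "\<And>h z. \<lbrakk>h holomorphic_on ball 0 1; h ` ball 0 1 \<subseteq> ball 0 1; cmod z \<le> R'\<rbrakk>
       \<Longrightarrow> cmod (h z - z) \<le> C * (cmod (h 0) + cmod (h (1/2) - 1/2))"
    using self_map_near_identity[OF R'(2)] by blast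
  \<comment> \<open>Chosen so that C(e + e) = (R' - R)/2, half the width of the annulus used by the
    Cauchy estimate.\<close>
  define e where "e = (R' - R) / (4 * C)"
  have e: "0 < e" using R' C by (simp add: e_def)
  obtain \<delta>1 where d1: "0 < \<delta>1"
    "\<And>s u t. \<lbrakk>0 \<le> s; s \<le> u; u \<le> t; t \<le> T; t - u < \<delta>1\<rbrakk> \<Longrightarrow> cmod (\<phi> s u 0 - \<phi> s t 0) < e"
    using equicontinuous[of 0 T e] T e by auto
  obtain \<delta>2 where d2: "0 < \<delta>2"
    "\<And>s u t. \<lbrakk>0 \<le> s; s \<le> u; u \<le> t; t \<le> T; t - u < \<delta>2\<rbrakk> \<Longrightarrow> cmod (\<phi> s u (1/2) - \<phi> s t (1/2)) < e"
    using equicontinuous[of "1/2" T e] T e by auto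
  show ?thesis
  proof (rule that[of "min \<delta>1 \<delta>2"])
    show "0 < min \<delta>1 \<delta>2" using d1 d2 by simp
    fix s t assume st: "0 \<le> s" "s \<le> t" "t \<le> T" "t - s < min \<delta>1 \<delta>2"
    have 0: "cmod (\<phi> s t 0) < e" using d1(2)[of s s t] st refl[of s 0] by simp
    have 1: "cmod (\<phi> s t (1/2) - 1/2) < e" using d2(2)[of s s t] st refl[of s "1/2"] by (simp add: norm_minus_commute)
    have near: "cmod (\<phi> s t z - z) \<le> (R' - R) / 2" if "cmod z \<le> R'" for z
    proof -
      have "cmod (\<phi> s t z - z) \<le> C * (cmod (\<phi> s t 0) + cmod (\<phi> s t (1/2) - 1/2))"
        by (rule C(2)[OF hol into that]) (use st in auto)
      also have "\<dots> \<le> C * (e + e)" using 0 1 C by (intro mult_left_mono) auto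
      also have "\<dots> = (R' - R) / 2" using C by (simp add: e_def)
      finally show ?thesis .
    qed
    show "inj_on (\<phi> s t) (cball 0 R)"
    proof (rule inj_onI, rule ccontr)
      fix z w assume zw: "z \<in> cball 0 R" "w \<in> cball 0 R" "\<phi> s t z = \<phi> s t w" "z \<noteq> w"
      have Lip: "cmod ((\<phi> s t z - z) - (\<phi> s t w - w)) \<le> (R' - R) / 2 / (R' - R) * cmod (z - w)"
        by (rule holomorphic_bounded_imp_Lipschitz[OF _ R'(1,2) near])
           (use zw hol[of s t] st in \<open>auto intro!: holomorphic_intros\<close>)
      have half: "(R' - R) / 2 / (R' - R) = 1 / 2" using R' by simp
      show False using Lip zw(3,4) unfolding half by (simp add: norm_minus_commute)
    qed
  qed
qed

text \<open>The orbits of two distinct points stay in one \<open>cball 0 R\<close>, on which every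
  time step shorter than \<delta> is injective; finitely many such steps reach T.\<close>

lemma \<phi>_inj:
  assumes s: "0 \<le> s" "s \<le> T"
  shows "inj_on (\<phi> s T) (ball 0 1)"
proof (rule inj_onI, rule ccontr)
  fix z w assume zw: "z \<in> ball 0 1" "w \<in> ball 0 1" "\<phi> s T z = \<phi> s T w" "z \<noteq> w"
  have z1: "cmod z < 1" "cmod w < 1" using zw by auto
  \<comment> \<open>The horizon is T + 1 because T may be 0 and the uniform bounds ask for a
    positive horizon.\<close>
  have T: "0 < T + 1" using s by simp
  obtain R where R: "0 < R" "R < 1"
    "\<And>s t x. \<lbrakk>0 \<le> s; s \<le> t; t \<le> T + 1; cmod x \<le> max (cmod z) (cmod w)\<rbrakk> \<Longrightarrow> cmod (\<phi> s t x) \<le> R"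
    using uniform_bound[OF T, of "max (cmod z) (cmod w)"] z1 by auto
  obtain \<delta> where \<delta>: "0 < \<delta>"
    "\<And>s t. \<lbrakk>0 \<le> s; s \<le> t; t \<le> T + 1; t - s < \<delta>\<rbrakk> \<Longrightarrow> inj_on (\<phi> s t) (cball 0 R)"
    using locally_injective[OF T R(1,2)] by blast
  have sep: "\<phi> s v z \<noteq> \<phi> s v w" if "s \<le> v" "v \<le> T" "v - s \<le> real n * (\<delta> / 2)" for n v
    using that
  proof (induction n arbitrary: v)
    case 0
    then have "v = s" by simp
    then show ?case using refl s z1 zw by simp
  next
    case (Suc n)
    \<comment> \<open>Steps of length \<delta>/2 keep the strict inequality v - u < \<delta>; the
      maximum stops at the initial time.\<close>
    define u where "u = max s (v - \<delta> / 2)"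
    have "0 \<le> real n * (\<delta> / 2)" using \<delta>(1) by simp
    then have u: "s \<le> u" "u \<le> v" "v - u < \<delta>" "u - s \<le> real n * (\<delta> / 2)"
      using Suc.prems \<delta>(1) by (auto simp: u_def max_def algebra_simps)
    have "\<phi> s u z \<noteq> \<phi> s u w" using Suc.IH[of u] u Suc.prems by simp
    moreover have "\<phi> s u z \<in> cball 0 R" "\<phi> s u w \<in> cball 0 R" using R(3) u Suc.prems s by auto
    moreover have "inj_on (\<phi> u v) (cball 0 R)" using \<delta>(2) u Suc.prems s by auto
    ultimately have "\<phi> u v (\<phi> s u z) \<noteq> \<phi> u v (\<phi> s u w)" by (meson inj_onD)
    then show ?case using comp[of s u v z] comp[of s u v w] u s z1 by simp
  qed
  obtain n where "(T - s) / (\<delta> / 2) \<le> real n" using real_arch_simple by blast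
  then have "T - s \<le> real n * (\<delta> / 2)" using \<delta>(1) by (simp add: field_simps)
  then show False using sep[of T n] s zw by simp
qed

sublocale rad: radial_family \<psi>
proof
  fix s t :: real assume st: "0 \<le> s" "s \<le> t"
  show "\<psi> s t holomorphic_on ball 0 1" "\<psi> s t 0 = 0" "\<psi> s t ` ball 0 1 \<subseteq> ball 0 1"
    using \<psi>_hol \<psi>_zero \<psi>_less st by auto
  have as: "cmod (- a s) < 1" using a_less st by simp
  have "inj_on (Moebius_function 0 (a t)) (\<phi> s t ` Moebius_function 0 (- a s) ` ball 0 1)"
    by (rule inj_on_subset[OF Moebius_inj]) (use st in \<open>auto simp: a_less Moebius_less norm_less\<close>)
  moreover have "inj_on (\<phi> s t) (Moebius_function 0 (- a s) ` ball 0 1)"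
    by (rule inj_on_subset[OF \<phi>_inj]) (use st in \<open>auto simp: a_less Moebius_less\<close>)
  ultimately show "inj_on (\<psi> s t) (ball 0 1)"
    unfolding \<psi>_def using Moebius_inj[OF as] by (auto intro!: comp_inj_on simp: image_comp)
next
  fix s :: real and z assume "0 \<le> s" "cmod z < 1"
  then show "\<psi> s s z = z" by (simp add: \<psi>_def refl Moebius_less Moebius_inverse a_less)
next
  fix s u t :: real and z assume st: "0 \<le> s" "s \<le> u" "u \<le> t" and z: "cmod z < 1"
  let ?w = "Moebius_function 0 (- a s) z"
  have w: "cmod ?w < 1" using Moebius_less st z by simp
  show "\<psi> s t z = \<psi> u t (\<psi> s u z)"
    using comp[OF st w] st w by (simp add: \<psi>_def Moebius_inverse a_less norm_less)
next
  have "continuous_on {0..} a" unfolding a_def[abs_def] by (rule continuous_in_time) simp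
  moreover have "1 - cnj (a t) * \<phi> 0 t (1/2) \<noteq> 0" if "t \<in> {0..}" for t
    using that by (intro one_minus_cnj_mult_nonzero) (auto simp: a_less norm_less less_imp_le)
  ultimately have "continuous_on {0..} (\<lambda>t. (\<phi> 0 t (1/2) - a t) / (1 - cnj (a t) * \<phi> 0 t (1/2)))"
    using continuous_in_time[of "1/2"] by (intro continuous_intros) auto
  moreover have "a 0 = 0" by (simp add: a_def refl)
  ultimately show "continuous_on {0..} (\<lambda>t. \<psi> 0 t (1/2))"
    by (simp add: \<psi>_def Moebius_function_simple[of "a _"])
qed

section \<open>The Loewner chain\<close>

definition f :: "real \<Rightarrow> complex \<Rightarrow> complex" where "f t = rad.g t \<circ> Moebius_function 0 (a t)"

lemma a_0: "a 0 = 0"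
  by (simp add: a_def refl)

lemma f_hol: "0 \<le> t \<Longrightarrow> f t holomorphic_on ball 0 1"
  unfolding f_def
  by (intro holomorphic_on_compose_gen[of _ _ _ "ball 0 1"] Moebius_function_holomorphic rad.g_holomorphic)
     (auto simp: a_less Moebius_less)

lemma f_inj: "0 \<le> t \<Longrightarrow> inj_on (f t) (ball 0 1)"
  unfolding f_def by (intro comp_inj_on Moebius_inj) (simp_all add: a_less Moebius_image_disk rad.g_inj)

lemma f_image: "0 \<le> t \<Longrightarrow> f t ` ball 0 1 = rad.g t ` ball 0 1"
  unfolding f_def image_comp[symmetric] by (simp add: Moebius_image_disk a_less)

lemma f_comp:
  assumes "0 \<le> s" "s \<le> t" "cmod z < 1"
  shows "f t (\<phi> s t z) = f s z"
  using rad.g_comp[of s t "Moebius_function 0 (a s) z"] assms Moebius_less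
  by (simp add: f_def \<psi>_conj)

lemma f_normalized: "normalized_chain f"
proof -
  have "f 0 = rad.g 0" by (simp add: f_def a_0 fun_eq_iff)
  moreover have "rad.c 0 0 = 1"
    using rad.c_mult[of 0 0 0] rad.c_nonzero[of 0 0] by simp
  ultimately show ?thesis
    unfolding normalized_chain_def using rad.g_zero[of 0] rad.g_deriv[of 0] by simp
qed

text \<open>Uniformity in t comes from f t = f T o \<phi> t T: only the single function f T must be
  bounded, on a compact set containing all the images, while \<phi> t T is bounded by 1.\<close>

lemma f_Lipschitz:
  assumes T: "0 < T" and R: "R < 1"
  obtains L where "0 \<le> L"
    "\<And>t z w. \<lbrakk>0 \<le> t; t \<le> T; cmod z \<le> R; cmod w \<le> R\<rbrakk> \<Longrightarrow> cmod (f t z - f t w) \<le> L * cmod (z - w)"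
proof -
  obtain S where S: "0 < S" "S < 1" "\<And>s t z. \<lbrakk>0 \<le> s; s \<le> t; t \<le> T; cmod z \<le> R\<rbrakk> \<Longrightarrow> cmod (\<phi> s t z) \<le> S"
    using uniform_bound[OF T R] by blast
  define R' S' where "R' = (1 + R) / 2" and "S' = (1 + S) / 2"
  have R': "R < R'" "R' < 1" and S': "S < S'" "S' < 1" using R S by (auto simp: R'_def S'_def)
  have "continuous_on (cball 0 S') (f T)"
    using f_hol[of T] T S' by (intro holomorphic_on_imp_continuous_on) (auto intro: holomorphic_on_subset)
  then have "bounded (f T ` cball 0 S')" by (intro compact_imp_bounded compact_continuous_image) auto
  then obtain B where B: "0 < B" "\<And>z. cmod z \<le> S' \<Longrightarrow> cmod (f T z) \<le> B"
    unfolding bounded_pos by auto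
  show ?thesis
  proof (rule that[of "B / (S' - S) * (1 / (R' - R))"])
    show "0 \<le> B / (S' - S) * (1 / (R' - R))" using B R' S' by simp
    fix t z w assume t: "0 \<le> t" "t \<le> T" and z: "cmod z \<le> R" and w: "cmod w \<le> R"
    have "cmod (f t z - f t w) = cmod (f T (\<phi> t T z) - f T (\<phi> t T w))"
      using f_comp[of t T] t z w R by simp
    also have "\<dots> \<le> B / (S' - S) * cmod (\<phi> t T z - \<phi> t T w)"
      by (rule holomorphic_bounded_imp_Lipschitz[OF f_hol S' B(2)]) (use S(3) t z w T in auto)
    also have "\<dots> \<le> B / (S' - S) * (1 / (R' - R) * cmod (z - w))"
    proof (rule mult_left_mono)
      show "cmod (\<phi> t T z - \<phi> t T w) \<le> 1 / (R' - R) * cmod (z - w)"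
      proof (rule holomorphic_bounded_imp_Lipschitz[OF hol R' _ z w])
        show "cmod (\<phi> t T x) \<le> 1" if "cmod x \<le> R'" for x
          using norm_less[OF t, of x] that R' by simp
      qed (use t in auto)
    qed (use B S' in auto)
    finally show "cmod (f t z - f t w) \<le> B / (S' - S) * (1 / (R' - R)) * cmod (z - w)" by (simp only: mult.assoc)
  qed
qed

text \<open>f s z - f t z is the difference of f t at \<phi> s t z and at z, hence at most L times
  the displacement of z, and that is at most C times the displacements of 0 and 1/2. The latter have
  kernels not depending on z.\<close>

lemma f_kernel:
  assumes K: "compact K" "K \<subseteq> ball 0 1" and T: "0 < T"
  shows "\<exists>k. Ld_nonneg d T k \<and> (\<forall>z\<in>K. \<forall>s t. 0 \<le> s \<and> s \<le> t \<and> t \<le> T \<longrightarrow>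
           cmod (f s z - f t z) \<le> set_lebesgue_integral lebesgue {s..t} k)"
proof -
  obtain r where r: "r < 1" "K \<subseteq> cball 0 r"
    using compact_subset_ball_imp_subset_cball[OF K] by blast
  obtain R where R: "0 < R" "R < 1" "\<And>s t z. \<lbrakk>0 \<le> s; s \<le> t; t \<le> T; cmod z \<le> r\<rbrakk> \<Longrightarrow> cmod (\<phi> s t z) \<le> R"
    using uniform_bound[OF T r(1)] by blast
  obtain L where L: "0 \<le> L"
    "\<And>t z w. \<lbrakk>0 \<le> t; t \<le> T; cmod z \<le> R; cmod w \<le> R\<rbrakk> \<Longrightarrow> cmod (f t z - f t w) \<le> L * cmod (z - w)"
    using f_Lipschitz[OF T R(2)] by blast
  obtain C where C: "0 < C"
    "\<And>h z. \<lbrakk>h holomorphic_on ball 0 1; h ` ball 0 1 \<subseteq> ball 0 1; cmod z \<le> r\<rbrakk>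
       \<Longrightarrow> cmod (h z - z) \<le> C * (cmod (h 0) + cmod (h (1/2) - 1/2))"
    using self_map_near_identity[OF r(1)] by blast
  obtain k where k: "Ld_nonneg d T k"
    "\<And>s u t. \<lbrakk>0 \<le> s; s \<le> u; u \<le> t; t \<le> T\<rbrakk> \<Longrightarrow> cmod (\<phi> s u 0 - \<phi> s t 0) \<le> set_lebesgue_integral lebesgue {u..t} k"
    using kernel[of 0 T] T by auto
  obtain l where l: "Ld_nonneg d T l"
    "\<And>s u t. \<lbrakk>0 \<le> s; s \<le> u; u \<le> t; t \<le> T\<rbrakk> \<Longrightarrow> cmod (\<phi> s u (1/2) - \<phi> s t (1/2)) \<le> set_lebesgue_integral lebesgue {u..t} l"
    using kernel[of "1/2" T] T by auto
  have LC: "0 \<le> L * C" using L C by simp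
  show ?thesis
  proof (intro exI[of _ "\<lambda>x. L * C * (k x + l x)"] conjI ballI allI impI)
    show "Ld_nonneg d T (\<lambda>x. L * C * (k x + l x))" by (rule Ld_nonneg_scaled_add[OF d k(1) l(1) LC])
    fix z s t assume z: "z \<in> K" and st': "0 \<le> s \<and> s \<le> t \<and> t \<le> T"
    then have st: "0 \<le> s" "s \<le> t" "t \<le> T" by auto
    have zr: "cmod z \<le> r" "cmod z < 1" using z r K by auto
    \<comment> \<open>The bound R covers z itself because z = \<phi> s s z.\<close>
    have zR: "cmod z \<le> R" using R(3)[of s s z] refl[of s z] zr st by simp
    have "cmod (f s z - f t z) = cmod (f t (\<phi> s t z) - f t z)" using f_comp st zr by simp
    also have "\<dots> \<le> L * cmod (\<phi> s t z - z)" using L(2) R(3) st zr zR by simp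
    also have "\<dots> \<le> L * (C * (cmod (\<phi> s t 0) + cmod (\<phi> s t (1/2) - 1/2)))"
      by (intro mult_left_mono C(2) hol into st zr L)
    also have "\<dots> \<le> L * (C * (set_lebesgue_integral lebesgue {s..t} k + set_lebesgue_integral lebesgue {s..t} l))"
    proof (intro mult_left_mono add_mono)
      show "cmod (\<phi> s t 0) \<le> set_lebesgue_integral lebesgue {s..t} k"
        using k(2)[of s s t] refl[of s 0] st by simp
      show "cmod (\<phi> s t (1/2) - 1/2) \<le> set_lebesgue_integral lebesgue {s..t} l"
        using l(2)[of s s t] refl[of s "1/2"] st by (simp add: norm_minus_commute)
    qed (use C L in auto)
    also have "\<dots> = set_lebesgue_integral lebesgue {s..t} (\<lambda>x. L * C * (k x + l x))"
      using Ld_nonneg_subinterval_integrable[OF d k(1)] Ld_nonneg_subinterval_integrable[OF d l(1)] st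
      by (simp add: set_integral_add mult.assoc)
    finally show "cmod (f s z - f t z) \<le> set_lebesgue_integral lebesgue {s..t} (\<lambda>x. L * C * (k x + l x))" .
  qed
qed

lemma f_associated: "associated_with f \<phi>"
  unfolding associated_with_def by (simp add: f_comp)

lemma f_chain: "loewner_chain d f"
  unfolding loewner_chain_def
proof (intro conjI allI impI)
  fix s t :: real assume st: "0 \<le> s \<and> s < t"
  show "f s ` unit_disk \<subseteq> f t ` unit_disk"
  proof
    fix y assume "y \<in> f s ` unit_disk"
    then obtain z where z: "cmod z < 1" "y = f s z" by auto
    then show "y \<in> f t ` unit_disk"
      using f_comp[of s t z] norm_less[of s t z] st by (intro image_eqI[of _ _ "\<phi> s t z"]) auto
  qed
qed (use f_hol f_inj f_kernel in auto)

text \<open>Identifies the quantity defining \<beta>: the automorphism sending \<open>a t\<close> to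
  0 has derivative 1/(1 - |a t|^2) there, and at time 0 there is no change of coordinates since
  \<open>a 0 = 0\<close>.\<close>

lemma norm_c:
  assumes t: "0 \<le> t"
  shows "cmod (rad.c 0 t) = cmod (deriv (\<phi> 0 t) 0) / (1 - (cmod (\<phi> 0 t 0))\<^sup>2)"
proof -
  have 1: "\<phi> 0 t field_differentiable at 0"
    using hol[of 0 t] t by (auto intro: holomorphic_on_imp_differentiable_at[of _ "ball 0 1"])
  have 2: "Moebius_function 0 (a t) field_differentiable at (\<phi> 0 t 0)"
    using Moebius_function_holomorphic[OF a_less[OF t]] norm_less[of 0 t 0] t
    by (auto intro: holomorphic_on_imp_differentiable_at[of _ "ball 0 1"])
  have "\<psi> 0 t = Moebius_function 0 (a t) \<circ> \<phi> 0 t" by (simp add: \<psi>_def a_0 fun_eq_iff)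
  then have "rad.c 0 t = deriv (Moebius_function 0 (a t)) (a t) * deriv (\<phi> 0 t) 0"
    unfolding rad.c_def using deriv_chain[OF 1 2] by (simp add: a_def)
  moreover have "(cmod (a t))\<^sup>2 < 1" using a_less[OF t] by (simp add: abs_square_less_1)
  moreover have "cmod (1 - complex_of_real ((cmod (a t))\<^sup>2)) = 1 - (cmod (a t))\<^sup>2"
    using calculation norm_of_real[of "1 - (cmod (a t))\<^sup>2", where 'a=complex] by simp
  ultimately show ?thesis
    unfolding deriv_Moebius_centre[OF a_less[OF t]] norm_mult norm_divide by (simp add: a_def norm_divide)
qed

text \<open>The multipliers are multiplicative with modulus at most 1, so |c 0 t| decreases to its
  infimum. Existence of the limit has to be proved because \<open>Lim\<close> in the theorem is a
  choice operator.\<close>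

lemma norm_c_convergent: "\<exists>\<beta>. ((\<lambda>t. cmod (rad.c 0 t)) \<longlongrightarrow> \<beta>) at_top"
proof -
  define \<beta> where "\<beta> = (INF t\<in>{0..}. cmod (rad.c 0 t))"
  have bdd: "bdd_below ((\<lambda>t. cmod (rad.c 0 t)) ` {0..})" by (rule bdd_belowI[of _ 0]) auto
  have "((\<lambda>t. cmod (rad.c 0 t)) \<longlongrightarrow> \<beta>) at_top"
  proof (rule decreasing_tendsto)
    show "\<forall>\<^sub>F t in at_top. \<beta> \<le> cmod (rad.c 0 t)"
      using eventually_ge_at_top[of 0] by eventually_elim (auto simp: \<beta>_def intro!: cINF_lower bdd)
    fix x assume "\<beta> < x"
    then obtain s where s: "0 \<le> s" "cmod (rad.c 0 s) < x"
      unfolding \<beta>_def using cINF_less_iff[OF _ bdd] by auto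
    show "\<forall>\<^sub>F t in at_top. cmod (rad.c 0 t) < x"
      using eventually_ge_at_top[of s]
    proof eventually_elim
      case (elim t)
      have "cmod (rad.c 0 t) = cmod (rad.c s t) * cmod (rad.c 0 s)"
        using rad.c_mult[of 0 s t] s elim by (simp add: norm_mult)
      also have "\<dots> \<le> cmod (rad.c 0 s)" using rad.c_norm_le_1[of s t] s elim by (simp add: mult_left_le_one_le)
      finally show ?case using s by simp
    qed
  qed
  then show ?thesis by blast
qed

end

theorem theorem3p3:
  fixes d :: ereal and \<phi> :: "real \<Rightarrow> real \<Rightarrow> complex \<Rightarrow> complex"
  assumes "1 \<le> d"
    and "evolution_family d \<phi>"
  defines "\<beta> \<equiv> Lim at_top (\<lambda>t::real. cmod (deriv (\<phi> 0 t) 0) / (1 - (cmod (\<phi> 0 t 0))\<^sup>2))"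
  shows "\<exists>f. loewner_chain d f \<and> normalized_chain f \<and> associated_with f \<phi> \<and>
           (\<beta> > 0 \<longrightarrow> (\<Union>t\<in>{0..}. f t ` unit_disk) = ball 0 (1 / \<beta>)) \<and>
           (\<beta> = 0 \<longrightarrow> (\<Union>t\<in>{0..}. f t ` unit_disk) = UNIV)"
proof -
  interpret E: disk_evolution d \<phi> by unfold_locales fact+
  obtain b where b: "((\<lambda>t. cmod (E.rad.c 0 t)) \<longlongrightarrow> b) at_top" using E.norm_c_convergent by blast
  have "((\<lambda>t. cmod (deriv (\<phi> 0 t) 0) / (1 - (cmod (\<phi> 0 t 0))\<^sup>2)) \<longlongrightarrow> b) at_top"
  proof (rule Lim_transform_eventually[OF b])
    show "\<forall>\<^sub>F t in at_top. cmod (E.rad.c 0 t) = cmod (deriv (\<phi> 0 t) 0) / (1 - (cmod (\<phi> 0 t 0))\<^sup>2)"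
      using eventually_ge_at_top[of 0] by eventually_elim (rule E.norm_c)
  qed
  then have "\<beta> = b" unfolding \<beta>_def by (intro tendsto_Lim) auto
  moreover have "(\<Union>t\<in>{0..}. E.f t ` unit_disk) = (\<Union>t\<in>{0..}. E.rad.g t ` unit_disk)"
    using E.f_image by auto
  ultimately show ?thesis
    using E.f_chain E.f_normalized E.f_associated E.rad.g_range_disk[of b] E.rad.g_range_plane b
    by (intro exI[of _ E.f]) auto
qed

end
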